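(* Let $p$ be a prime and let $f(x)\in\mathbb{F}_p[x]$ be a polynomial of degree $d$ with $0<d<p$. Let $D\subseteq\mathbb{F}_p$ be a subset with $|D|=p-c\geq (d-1)\sqrt{p}+c$, let $b\in\mathbb{F}_p$, let $k$ be an integer with $0\le k\le|D|$, and let $N_f(D,k,b)$ be the number of $k$-element subsets $S\subseteq D$ such that $\sum_{x\in S}f(x)=b$. Then $$\left| N_f(D, k, b)-\frac{1}{p}\binom{p-c}{k}\right|\leq \binom{(d-1)p^{\frac 12}+c+k}{k}.$$
   Context: For a real number $x$ and an integer $k\ge 0$, $\binom{x}{k}=\frac{(x)_k}{k!}$ with $(x)_0=1$ and $(x)_k=x(x-1)\cdots(x-k+1)$ for $k\geq 1$. *)

theory Defs
  imports Complex_Main "Berlekamp_Zassenhaus.Finite_Field"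
begin

text \<open>The prime field of order \<open>p\<close> is \<open>'p mod_ring\<close> with \<open>'p :: prime_card\<close> and
  \<open>p = CARD('p)\<close>. This type is finite, so every subset \<open>S\<close> below is finite and \<open>card S\<close> is
  its true number of elements.\<close>

definition subset_sum_count ::
  "'p::prime_card mod_ring poly \<Rightarrow> 'p mod_ring set \<Rightarrow> nat \<Rightarrow> 'p mod_ring \<Rightarrow> nat"
  where "subset_sum_count f D k b =
    card {S. S \<subseteq> D \<and> card S = k \<and> (\<Sum>x\<in>S. poly f x) = b}"

end

theory Submission
  imports "HOL-Algebra.Algebraic_Closure_Type" Defs
begin

text \<open>Expanding the condition \<open>\<Sum>f(x) = b\<close> in additive characters turns the
  count into an average of elementary symmetric functions of the values
  \<open>\<psi>(f(x))\<close>, \<open>x \<in> D\<close>. Their power sums are incomplete character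
  sums, which the Weil bound \<open>\<bar>\<Sum>\<psi>(f(x))\<bar> \<le> (d - 1)\<surd>p\<close>
  controls, and Newton's identities then compare the elementary symmetric functions with the
  coefficients of \<open>(1 - t)\<^sup>-\<^sup>B\<close> for \<open>B = (d - 1)\<surd>p +
  c\<close>. If \<open>k = p\<close>, one of these power sums is trivial, but there the count is
  \<open>0\<close> or \<open>1\<close>.

  The Weil bound is obtained by Stepanov's method. Over the field with \<open>q =
  p\<^sup>2\<^sup>r\<close> elements, an auxiliary polynomial shows that each fibre of \<open>Tr
  \<circ> f\<close> has at most \<open>q/p + O(\<surd>q)\<close> elements, so the character sum
  over that field is \<open>O(\<surd>q)\<close> with a constant independent of \<open>r\<close>.
  The L-function of \<open>f\<close>, a sum over monic polynomials, is a polynomial of degree less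
  than \<open>d\<close>, and the character sums over the extensions are, up to sign, the power
  sums of its reciprocal roots. Hence each of these at most \<open>d - 1\<close> roots has
  absolute value at most \<open>\<surd>p\<close>.\<close>

section \<open>Stepanov's method\<close>

text \<open>Gaussian elimination: a pivot \<open>j\<close> clears the coefficient at
  \<open>E\<close> from the other members, leaving one polynomial and one coefficient fewer. The
  family is indexed, so repeated polynomials count separately.\<close>

lemma polys_linearly_dependent:
  fixes P :: "'i \<Rightarrow> 'a::field poly"
  assumes "finite I" "card I > E" "\<And>i. i \<in> I \<Longrightarrow> \<forall>n\<ge>E. coeff (P i) n = 0"
  shows "\<exists>c. (\<exists>i\<in>I. c i \<noteq> 0) \<and> (\<Sum>i\<in>I. smult (c i) (P i)) = 0"
  using assms
proof (induction E arbitrary: I P)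
  case 0
  then have "P i = 0" if "i \<in> I" for i
    using that by (auto intro: poly_eqI)
  moreover obtain i where "i \<in> I"
    using 0 by fastforce
  ultimately show ?case
    by (intro exI[of _ "\<lambda>_. 1"]) auto
next
  case (Suc E)
  show ?case
  proof (cases "\<forall>i\<in>I. coeff (P i) E = 0")
    case True
    then have "\<forall>n\<ge>E. coeff (P i) n = 0" if "i \<in> I" for i
      using Suc.prems(3)[OF that] that by (metis Suc_leI le_neq_implies_less)
    then show ?thesis
      using Suc.prems by (intro Suc.IH) auto
  next
    case False
    then obtain j where j: "j \<in> I" "coeff (P j) E \<noteq> 0"
      by auto
    define a where "a i = coeff (P i) E / coeff (P j) E" for i
    define P' where "P' i = P i - smult (a i) (P j)" for i
    have "\<exists>c. (\<exists>i\<in>I - {j}. c i \<noteq> 0) \<and> (\<Sum>i\<in>I - {j}. smult (c i) (P' i)) = 0"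
    proof (rule Suc.IH)
      show "\<forall>n\<ge>E. coeff (P' i) n = 0" if "i \<in> I - {j}" for i
      proof (intro allI impI)
        fix n assume "n \<ge> E"
        then consider "n = E" | "n \<ge> Suc E" by linarith
        then show "coeff (P' i) n = 0"
          using that j Suc.prems(3)[of i] Suc.prems(3)[of j]
          by cases (auto simp: P'_def a_def)
      qed
    qed (use Suc.prems j in auto)
    then obtain c i where c: "i \<in> I - {j}" "c i \<noteq> 0" "(\<Sum>i\<in>I - {j}. smult (c i) (P' i)) = 0"
      by blast
    define c' where "c' i = (if i = j then - (\<Sum>i\<in>I - {j}. c i * a i) else c i)" for i
    have "(\<Sum>i\<in>I. smult (c' i) (P i)) =
        smult (c' j) (P j) + (\<Sum>i\<in>I - {j}. smult (c i) (P i))"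
      using Suc.prems j by (subst sum.remove[of I j]) (auto simp: c'_def)
    also have "\<dots> = (\<Sum>i\<in>I - {j}. smult (c i) (P' i))"
      by (simp add: c'_def P'_def smult_diff_right sum_subtractf smult_sum)
    finally show ?thesis
      using c by (intro exI[of _ c']) (auto simp: c'_def intro!: bexI[of _ i])
  qed
qed

text \<open>Among the terms with nonzero scalar, the one of largest degree is unique, so nothing
  cancels its leading coefficient.\<close>

lemma sum_distinct_degree_nonzero:
  fixes P :: "'i \<Rightarrow> 'a::field poly"
  assumes "finite I" "inj_on (\<lambda>i. degree (P i)) I" "\<And>i. i \<in> I \<Longrightarrow> P i \<noteq> 0"
    and "\<exists>i\<in>I. c i \<noteq> 0"
  shows "(\<Sum>i\<in>I. smult (c i) (P i)) \<noteq> 0"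
proof -
  define J where "J = {i \<in> I. c i \<noteq> 0}"
  have fin: "finite ((\<lambda>i. degree (P i)) ` J)" and ne: "(\<lambda>i. degree (P i)) ` J \<noteq> {}"
    using assms by (auto simp: J_def)
  obtain j where j: "j \<in> J" "degree (P j) = Max ((\<lambda>i. degree (P i)) ` J)"
    using Max_in[OF fin ne] by auto
  have less: "degree (P i) < degree (P j)" if "i \<in> J" "i \<noteq> j" for i
  proof -
    have "degree (P i) \<le> degree (P j)"
      using that fin j by auto
    moreover have "degree (P i) \<noteq> degree (P j)"
      using that j assms(2) by (auto simp: J_def inj_on_def)
    ultimately show ?thesis by simp
  qed
  have "coeff (\<Sum>i\<in>I. smult (c i) (P i)) (degree (P j)) =
      (\<Sum>i\<in>{j}. c i * coeff (P i) (degree (P j)))"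
    unfolding coeff_sum coeff_smult
  proof (rule sum.mono_neutral_right)
    show "\<forall>i\<in>I - {j}. c i * coeff (P i) (degree (P j)) = 0"
    proof
      fix i assume "i \<in> I - {j}"
      then show "c i * coeff (P i) (degree (P j)) = 0"
        using less[of i] by (cases "c i = 0") (auto simp: J_def coeff_eq_0)
    qed
  qed (use assms j in \<open>auto simp: J_def\<close>)
  also have "\<dots> \<noteq> 0"
    using j(1) assms(3) by (auto simp: J_def)
  finally show ?thesis by auto
qed

section \<open>Frobenius powers and traces in the algebraic closure\<close>

interpretation to_ac_hom: map_poly_inj_idom_divide_hom to_ac
  by unfold_locales auto

lemma ac_power_sum:
  fixes g :: "'i \<Rightarrow> 'p::prime_card mod_ring alg_closure"
  shows "(\<Sum>i\<in>A. g i) ^ (CARD('p) ^ n) = (\<Sum>i\<in>A. g i ^ (CARD('p) ^ n))"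
  by (rule freshmans_dream_sum') (auto simp: prime_card)

lemma ac_power_add:
  fixes x y :: "'p::prime_card mod_ring alg_closure"
  shows "(x + y) ^ (CARD('p) ^ n) = x ^ (CARD('p) ^ n) + y ^ (CARD('p) ^ n)"
  by (rule freshmans_dream') (auto simp: prime_card)

lemma ac_power_diff:
  fixes x y :: "'p::prime_card mod_ring alg_closure"
  shows "(x - y) ^ (CARD('p) ^ n) = x ^ (CARD('p) ^ n) - y ^ (CARD('p) ^ n)"
  using ac_power_add[of "x - y" y n] by simp

lemma to_ac_power_card [simp]:
  fixes a :: "'p::prime_card mod_ring"
  shows "to_ac a ^ (CARD('p) ^ n) = to_ac a"
  using finite_field_power_card_power_eq_same[of "CARD('p) ^ n" n a]
  by (simp flip: to_ac_power)

lemma poly_ac_power: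
  fixes f :: "'p::prime_card mod_ring poly"
  shows "poly (map_poly to_ac f) x ^ (CARD('p) ^ n) = poly (map_poly to_ac f) (x ^ (CARD('p) ^ n))"
  by (simp add: poly_altdef ac_power_sum power_mult_distrib flip: power_mult)
    (simp add: mult.commute)

definition ac_trace :: "nat \<Rightarrow> 'p::prime_card mod_ring alg_closure \<Rightarrow> 'p mod_ring alg_closure"
  where "ac_trace n y = (\<Sum>i<n. y ^ (CARD('p) ^ i))"

definition trace_fiber ::
  "'p::prime_card mod_ring poly \<Rightarrow> nat \<Rightarrow> 'p mod_ring \<Rightarrow> 'p mod_ring alg_closure set"
  where "trace_fiber f n b =
    {x. x ^ (CARD('p) ^ n) = x \<and> ac_trace n (poly (map_poly to_ac f) x) = to_ac b}"

lemma degree_frobenius_sum: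
  fixes f :: "'a::idom poly"
  assumes "degree f > 0" "p > 1"
  shows "degree (\<Sum>i<Suc s. f ^ (p ^ i)) = degree f * p ^ s"
proof (induction s)
  case (Suc s)
  have "f \<noteq> 0" using assms by auto
  have "degree (\<Sum>i<Suc s. f ^ (p ^ i)) < degree (f ^ (p ^ Suc s))"
    unfolding Suc using assms \<open>f \<noteq> 0\<close> by (auto simp: degree_power_eq)
  then show ?case
    by (subst sum.lessThan_Suc, subst degree_add_eq_right) (use assms \<open>f \<noteq> 0\<close> in \<open>auto simp: degree_power_eq\<close>)
qed simp

text \<open>Put \<open>q = p ^ r\<close> and \<open>F = \<Sum>i<r. f ^ (p ^ i)\<close>. On the
  fibre, \<open>x ^ (q * q) = x\<close> and \<open>F(x) ^ q = b - F(x)\<close>. For a linear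
  combination \<open>G\<close> of the polynomials \<open>x ^ (u + q * v) * F ^ w\<close> over the
  prime field, this makes \<open>G(x) ^ q\<close> the value at \<open>x\<close> of the same
  combination of the polynomials \<open>x ^ (q * u + v) * (b - F) ^ w\<close>, whose degrees are
  so small that some nontrivial combination of them vanishes. The first family has distinct
  degrees, so \<open>G\<close> is nonzero, and the fibre consists of roots of
  \<open>G\<close>.\<close>
lemma card_trace_fiber_le:
  fixes f :: "'p::prime_card mod_ring poly" and b :: "'p mod_ring"
  defines "p \<equiv> CARD('p)" and "d \<equiv> degree f"
  assumes d: "0 < d" "d < p" and r: "r \<ge> 2"
  shows "card (trace_fiber f (2 * r) b) \<le> p ^ (2 * r - 1) + (2 * d + 2) * p ^ r"
proof -
  have p: "prime p" "p > 1"
    using prime_card prime_gt_1_nat unfolding p_def by auto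
  define Q where "Q = p ^ (r - 1)"
  define q where "q = p ^ r"
  have qQ: "q = p * Q"
    using r by (cases r) (auto simp: q_def Q_def)
  have pQ: "p \<le> Q" "Q > 0"
    using r p self_le_power[of p "r - 1"] by (auto simp: Q_def)
  define F where "F = (\<Sum>i<r. f ^ (p ^ i))"
  have degF: "degree F = d * Q"
    using degree_frobenius_sum[of f p "r - 1"] d p r by (simp add: F_def Q_def d_def)
  define M where "M = Q + d + 2"
  define I where "I = {..<Q} \<times> {..<M} \<times> {..<p}"
  define P where "P = (\<lambda>(u, v, w). monom 1 (u + q * v) * F ^ w)"
  define R where "R = (\<lambda>(u, v, w). monom 1 (q * u + v) * ([:b:] - F) ^ w)"
  have F0: "F \<noteq> 0" using degF d pQ by auto
  have finI: "finite I" by (simp add: I_def)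
  have cardI: "card I = Q * M * p" by (simp add: I_def)
  define E where "E = q * Q + M + d * q"
  have degP: "degree (P (u, v, w)) = u + Q * (p * v + d * w)" for u v w
    using F0 by (simp add: P_def degree_mult_eq degree_monom_eq degree_power_eq degF qQ algebra_simps)
  have degR: "degree (R (u, v, w)) \<le> q * u + v + d * Q * w" for u v w
  proof -
    have "degree ([:b:] - F) \<le> d * Q"
      using degF by (intro degree_diff_le) auto
    then have "degree (([:b:] - F) ^ w) \<le> d * Q * w"
      using degree_power_le[of "[:b:] - F" w] by (meson le_trans mult_le_mono1)
    then show ?thesis
      using degree_mult_le[of "monom (1::'p mod_ring) (q * u + v)" "([:b:] - F) ^ w"]
      by (simp add: R_def degree_monom_eq)
  qed
  have "\<exists>c. (\<exists>i\<in>I. c i \<noteq> 0) \<and> (\<Sum>i\<in>I. smult (c i) (R i)) = 0"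
  proof (rule polys_linearly_dependent[OF finI])
    have "M < 2 * q"
    proof -
      have "2 * Q \<le> q" using p by (simp add: qQ)
      moreover have "p \<ge> 2" using p by simp
      ultimately show ?thesis using pQ d unfolding M_def by linarith
    qed
    then have "E < q * M"
      unfolding E_def M_def by (simp add: algebra_simps)
    then show "E < card I"
      by (simp add: cardI qQ mult_ac)
    show "\<forall>n\<ge>E. coeff (R i) n = 0" if iI: "i \<in> I" for i
    proof -
      obtain u v w where i: "i = (u, v, w)" "u < Q" "v < M" "w < p"
        using iI by (auto simp: I_def)
      have "q * u \<le> q * Q" "d * Q * w \<le> d * Q * p"
        using i by auto
      moreover have "d * Q * p = d * q"
        by (simp add: qQ)
      ultimately have "degree (R i) < E"
        using degR[of u v w] i unfolding E_def i(1) by linarith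
      then show ?thesis
        by (simp add: coeff_eq_0)
    qed
  qed
  then obtain c where c: "\<exists>i\<in>I. c i \<noteq> 0" "(\<Sum>i\<in>I. smult (c i) (R i)) = 0"
    by blast
  define G where "G = (\<Sum>i\<in>I. smult (c i) (P i))"
  have "G \<noteq> 0"
    unfolding G_def
  proof (rule sum_distinct_degree_nonzero[OF finI _ _ c(1)])
    show "inj_on (\<lambda>i. degree (P i)) I"
    proof (rule inj_onI)
      fix i j assume ij: "i \<in> I" "j \<in> I" "degree (P i) = degree (P j)"
      obtain u v w where i: "i = (u, v, w)" "u < Q" "v < M" "w < p"
        using ij(1) by (auto simp: I_def)
      obtain u' v' w' where j: "j = (u', v', w')" "u' < Q" "v' < M" "w' < p"
        using ij(2) by (auto simp: I_def)
      \<comment> \<open>The degree determines the index: reduction modulo \<open>Q\<close> gives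
        \<open>u\<close>, then reduction modulo \<open>p\<close> gives \<open>w\<close> because
        \<open>0 < d < p\<close> makes \<open>d\<close> invertible, and \<open>v\<close>
        remains.\<close>
      have eq: "u + Q * (p * v + d * w) = u' + Q * (p * v' + d * w')"
        using ij(3) unfolding i j degP by simp
      have "u = u'"
        using arg_cong[OF eq, of "\<lambda>n. n mod Q"] i j by simp
      moreover from this have eq2: "p * v + d * w = p * v' + d * w'"
        using eq pQ by simp
      have "coprime d p"
        using d p by (metis coprime_commute dvd_imp_le linorder_not_less prime_imp_coprime)
      moreover have "[d * w = d * w'] (mod p)"
        using arg_cong[OF eq2, of "\<lambda>n. n mod p"] by (simp add: cong_def)
      ultimately have "[w = w'] (mod p)"
        by (simp add: cong_mult_lcancel_nat)
      then have "w = w'"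
        using i j by (simp add: cong_def)
      then show "i = j"
        using eq2 p \<open>u = u'\<close> i j by simp
    qed
    show "P i \<noteq> 0" for i
      using F0 by (auto simp: P_def split: prod.splits)
  qed
  have degG: "degree G \<le> p ^ (2 * r - 1) + (2 * d + 2) * p ^ r"
    unfolding G_def
  proof (rule degree_sum_le[OF finI])
    fix i assume "i \<in> I"
    then obtain u v w where i: "i = (u, v, w)" "u < Q" "v < M" "w < p"
      by (auto simp: I_def)
    have "degree (smult (c i) (P i)) \<le> u + Q * (p * v + d * w)"
      unfolding i using degree_smult_le degP by metis
    also have "p * v \<le> p * (M - 1)" "d * w \<le> d * p"
      using i by auto
    then have "u + Q * (p * v + d * w) \<le> Q + Q * (p * (M - 1) + d * p)"
      using i by (intro add_mono mult_le_mono) auto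
    also have "\<dots> \<le> q * Q + (2 * d + 2) * q"
      using p unfolding M_def qQ by (simp add: algebra_simps)
    also have "q * Q = p ^ (2 * r - 1)"
      using r by (simp add: q_def Q_def mult_2 flip: power_add)
    finally show "degree (smult (c i) (P i)) \<le> p ^ (2 * r - 1) + (2 * d + 2) * p ^ r"
      by (simp add: q_def)
  qed
  have "trace_fiber f (2 * r) b \<subseteq> {x. poly (map_poly to_ac G) x = 0}"
  proof safe
    fix x assume "x \<in> trace_fiber f (2 * r) b"
    then have x: "x ^ (p ^ (2 * r)) = x" "ac_trace (2 * r) (poly (map_poly to_ac f) x) = to_ac b"
      by (auto simp: trace_fiber_def p_def)
    have xqq: "(x ^ q) ^ q = x"
      using x(1) by (simp add: q_def mult_2 power_add flip: power_mult)
    let ?F = "poly (map_poly to_ac F) x"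
    have F_eq: "?F = (\<Sum>i<r. poly (map_poly to_ac f) x ^ (p ^ i))"
      by (simp add: F_def hom_distribs poly_sum)
    \<comment> \<open>The trace has \<open>2 * r\<close> terms; \<open>F\<close> collects the first
      \<open>r\<close>, and the \<open>q\<close>-th power moves them to the last
      \<open>r\<close>.\<close>
    have "?F + ?F ^ q = to_ac b"
    proof -
      have "?F ^ q = (\<Sum>i<r. poly (map_poly to_ac f) x ^ (p ^ (i + r)))"
        unfolding F_eq q_def p_def ac_power_sum by (simp add: power_add flip: power_mult)
      also have "\<dots> = (\<Sum>i\<in>{r..<2*r}. poly (map_poly to_ac f) x ^ (p ^ i))"
        by (rule sum.reindex_bij_witness[of _ "\<lambda>i. i - r" "\<lambda>i. i + r"]) auto
      finally show ?thesis
        using x(2) unfolding F_eq ac_trace_def p_def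
        by (simp add: lessThan_atLeast0 sum.atLeastLessThan_concat)
    qed
    then have Fq: "?F ^ q = to_ac b - ?F"
      by (metis add_diff_cancel_left')
    have "poly (map_poly to_ac G) x ^ q =
        (\<Sum>i\<in>I. to_ac (c i) * poly (map_poly to_ac (P i)) x ^ q)"
      by (simp add: G_def hom_distribs poly_sum q_def p_def ac_power_sum power_mult_distrib)
    also have "\<dots> = (\<Sum>i\<in>I. to_ac (c i) * poly (map_poly to_ac (R i)) x)"
    proof (rule sum.cong[OF refl])
      fix i assume "i \<in> I"
      obtain u v w where i: "i = (u, v, w)" by (cases i)
      have "poly (map_poly to_ac (P i)) x ^ q = (x ^ u * (x ^ q) ^ v * ?F ^ w) ^ q"
        by (simp add: i P_def hom_distribs poly_monom power_add power_mult)
      also have "\<dots> = (x ^ q) ^ u * ((x ^ q) ^ q) ^ v * (?F ^ q) ^ w"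
        by (simp add: power_mult_distrib mult_ac flip: power_mult)
      also have "\<dots> = poly (map_poly to_ac (R i)) x"
        unfolding Fq xqq by (simp add: i R_def hom_distribs poly_monom power_add power_mult)
      finally show "to_ac (c i) * poly (map_poly to_ac (P i)) x ^ q =
          to_ac (c i) * poly (map_poly to_ac (R i)) x"
        by simp
    qed
    also have "\<dots> = poly (map_poly to_ac (\<Sum>i\<in>I. smult (c i) (R i))) x"
      by (simp add: hom_distribs poly_sum)
    also have "\<dots> = 0"
      by (simp add: c(2))
    finally show "poly (map_poly to_ac G) x = 0"
      by simp
  qed
  moreover have "map_poly to_ac G \<noteq> 0"
    using \<open>G \<noteq> 0\<close> by simp
  ultimately have "card (trace_fiber f (2 * r) b) \<le> card {x. poly (map_poly to_ac G) x = 0}"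
    by (intro card_mono poly_roots_finite)
  also have "\<dots> \<le> degree (map_poly to_ac G)"
    using \<open>map_poly to_ac G \<noteq> 0\<close> by (rule card_poly_roots_bound)
  finally show ?thesis
    using degG by simp
qed

section \<open>Newton's identities\<close>

text \<open>Logarithmic derivative: a factor \<open>1 - w X\<close> contributes
  \<open>- w / (1 - w X)\<close>, a geometric series in \<open>w\<close>, and the sum over all
  factors produces the power sums.\<close>

lemma fps_deriv_prod_linear:
  fixes w :: "'i \<Rightarrow> 'a::comm_ring_1"
  assumes "finite A"
  shows "fps_deriv (\<Prod>i\<in>A. 1 - fps_const (w i) * fps_X) =
    - (\<Prod>i\<in>A. 1 - fps_const (w i) * fps_X) * Abs_fps (\<lambda>n. \<Sum>i\<in>A. w i ^ Suc n)"
  using assms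
proof (induction rule: finite_induct)
  case empty
  then show ?case by (simp add: fps_zero_def[symmetric])
next
  case (insert a A)
  define E where "E = (\<Prod>i\<in>A. 1 - fps_const (w i) * fps_X)"
  define g where "g = Abs_fps (\<lambda>n. w a ^ Suc n)"
  define G where "G = Abs_fps (\<lambda>n. \<Sum>i\<in>A. w i ^ Suc n)"
  have geo: "(1 - fps_const (w a) * fps_X) * g = fps_const (w a)"
  proof (rule fps_ext)
    show "((1 - fps_const (w a) * fps_X) * g) $ n = fps_const (w a) $ n" for n
      by (cases n) (simp_all add: g_def ring_distribs mult.assoc)
  qed
  have G': "Abs_fps (\<lambda>n. \<Sum>i\<in>insert a A. w i ^ Suc n) = g + G"
    using insert.hyps by (intro fps_ext) (simp add: g_def G_def)
  have "fps_deriv ((1 - fps_const (w a) * fps_X) * E) =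
      (1 - fps_const (w a) * fps_X) * fps_deriv E - fps_const (w a) * E"
    by (simp flip: fps_const_neg)
  also have "\<dots> = (1 - fps_const (w a) * fps_X) * (- E * G) - (1 - fps_const (w a) * fps_X) * g * E"
    using insert.IH by (simp add: E_def G_def geo)
  also have "\<dots> = - ((1 - fps_const (w a) * fps_X) * E) * (g + G)"
    by (simp add: algebra_simps)
  finally show ?case
    using insert.hyps unfolding G' by (simp add: E_def)
qed

lemma fps_log_deriv_nth:
  fixes E G :: "'a::comm_ring_1 fps"
  assumes "fps_deriv E = - E * G"
  shows "of_nat (Suc n) * E $ Suc n = - (\<Sum>i\<le>n. G $ i * E $ (n - i))"
proof -
  have "fps_deriv E = - (G * E)"
    by (simp add: assms mult.commute)
  from arg_cong[OF this, of "\<lambda>F. F $ n"] show ?thesis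
    by (simp add: fps_mult_nth atLeast0AtMost)
qed

lemma reflect_poly_prod_linear:
  fixes w :: "'i \<Rightarrow> 'a::field"
  shows "fps_of_poly (reflect_poly (\<Prod>i\<in>A. [:- w i, 1:])) = (\<Prod>i\<in>A. 1 - fps_const (w i) * fps_X)"
proof -
  have lin: "fps_of_poly [:1, - w i:] = 1 - fps_const (w i) * fps_X" for i
    by (rule fps_ext) (auto simp: coeff_pCons split: nat.splits)
  have refl: "reflect_poly [:- w i, 1:] = [:1, - w i:]" for i
    by (rule poly_eqI) (auto simp: reflect_poly_pCons' coeff_pCons split: nat.splits)
  show ?thesis
    by (simp only: reflect_poly_prod fps_of_poly_prod refl lin)
qed

text \<open>A polynomial \<open>h\<close> vanishing at all values of \<open>w\<close> other than
  \<open>w a\<close> isolates that value: shifted power sums weighted by the coefficients of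
  \<open>h\<close> add up to \<open>m * w a ^ r * poly h (w a)\<close>, where \<open>m\<close> is
  the multiplicity. Hence \<open>norm (w a) ^ r\<close> is at most a constant times
  \<open>R ^ r\<close>, and large \<open>r\<close> removes the constant.\<close>

lemma power_sum_growth:
  fixes w :: "'i \<Rightarrow> complex"
  assumes "finite A" "a \<in> A" "R > 0"
    and bound: "\<And>r. r \<ge> r0 \<Longrightarrow> norm (\<Sum>i\<in>A. w i ^ r) \<le> C * R ^ r"
  shows "norm (w a) \<le> R"
proof -
  define h where "h = (\<Prod>v\<in>w ` A - {w a}. [:- v, 1:])"
  define m where "m = card {i \<in> A. w i = w a}"
  have m: "m > 0"
    using assms(1,2) by (auto simp: m_def card_gt_0_iff)
  have h0: "poly h (w i) = 0" if "i \<in> A" "w i \<noteq> w a" for i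
    using that assms(1) by (auto simp: h_def poly_prod)
  have ha: "poly h (w a) \<noteq> 0"
    using assms(1) by (auto simp: h_def poly_prod)
  define D where "D = (\<Sum>k\<le>degree h. norm (coeff h k) * C * R ^ k) / (real m * norm (poly h (w a)))"
  have le: "norm (w a) ^ r \<le> D * R ^ r" if r: "r \<ge> r0" for r
  proof -
    have "(\<Sum>k\<le>degree h. coeff h k * (\<Sum>i\<in>A. w i ^ (r + k))) = (\<Sum>i\<in>A. w i ^ r * poly h (w i))"
      unfolding poly_altdef sum_distrib_left
      by (subst sum.swap) (simp add: power_add mult_ac)
    also have "\<dots> = (\<Sum>i\<in>{i \<in> A. w i = w a}. w i ^ r * poly h (w i))"
      using assms(1) h0 by (intro sum.mono_neutral_right) auto
    also have "\<dots> = of_nat m * (w a ^ r * poly h (w a))"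
      by (simp add: m_def)
    finally have "real m * (norm (w a) ^ r * norm (poly h (w a))) =
        norm (\<Sum>k\<le>degree h. coeff h k * (\<Sum>i\<in>A. w i ^ (r + k)))"
      by (simp add: norm_mult norm_power)
    also have "\<dots> \<le> (\<Sum>k\<le>degree h. norm (coeff h k) * (C * R ^ (r + k)))"
      using r by (intro sum_norm_le) (auto simp: norm_mult intro!: mult_left_mono bound)
    also have "\<dots> = (\<Sum>k\<le>degree h. norm (coeff h k) * C * R ^ k) * R ^ r"
      unfolding sum_distrib_right by (simp add: power_add mult_ac)
    finally show ?thesis
      using m ha by (simp add: D_def field_simps)
  qed
  show ?thesis
  proof (rule ccontr)
    assume "\<not> norm (w a) \<le> R"
    then have gt: "norm (w a) / R > 1"
      using assms(3) by simp
    then obtain n where n: "D < (norm (w a) / R) ^ n"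
      using real_arch_pow by blast
    also have "\<dots> \<le> (norm (w a) / R) ^ max n r0"
      using gt by (intro power_increasing) auto
    also have "\<dots> \<le> D"
      using le[of "max n r0"] assms(3) by (simp add: power_divide field_simps)
    finally show False by simp
  qed
qed

text \<open>The values of \<open>S\<close> are, up to sign, the power sums of the reciprocal roots
  of the polynomial with coefficients \<open>A\<close>. A bound on the even ones with the right
  order of growth, whatever the constant, limits the size of these roots.\<close>
lemma reciprocal_roots_bound:
  fixes A S :: "nat \<Rightarrow> complex"
  assumes A: "A 0 = 1" "\<And>m. m \<ge> d \<Longrightarrow> A m = 0"
    and rec: "\<And>m. of_nat (Suc m) * A (Suc m) = (\<Sum>n\<le>m. S (Suc n) * A (m - n))"
    and R: "R > 0"
    and bound: "\<And>r. r \<ge> r0 \<Longrightarrow> norm (S (2 * r)) \<le> C * (R ^ 2) ^ r"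
  shows "norm (S 1) \<le> (real d - 1) * R"
proof -
  have d: "d > 0"
    using A by (metis gr0I le_refl zero_neq_one)
  \<comment> \<open>\<open>L\<close> is the reversal of the polynomial with coefficients
    \<open>A\<close>. As \<open>A 0 = 1\<close>, it is monic of degree exactly \<open>d - 1\<close>,
    so it has \<open>d - 1\<close> roots with multiplicity, some of them zero if
    \<open>A (d - 1) = 0\<close>.\<close>
  define L where "L = (\<Sum>m<d. monom (A m) (d - 1 - m))"
  have coeff_L: "coeff L k = (if k < d then A (d - 1 - k) else 0)" for k
  proof -
    have "coeff L k = (\<Sum>m<d. if m = d - 1 - k \<and> k < d then A m else 0)"
      unfolding L_def coeff_sum coeff_monom by (intro sum.cong) auto
    also have "\<dots> = (if k < d then A (d - 1 - k) else 0)"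
      using d by (auto simp: sum.delta)
    finally show ?thesis .
  qed
  have deg_L: "degree L = d - 1"
  proof (rule antisym)
    show "degree L \<le> d - 1"
      by (rule degree_le) (use d in \<open>auto simp: coeff_L\<close>)
    show "d - 1 \<le> degree L"
      by (rule le_degree) (use d A in \<open>auto simp: coeff_L\<close>)
  qed
  have lead: "lead_coeff L = 1"
    using d A by (simp add: deg_L coeff_L)
  obtain Z where Z: "size Z = degree L" "L = smult (lead_coeff L) (\<Prod>x\<in>#Z. [:- x, 1:])"
    using alg_closed_imp_factorization[of L] lead by (metis leading_coeff_0_iff zero_neq_one)
  obtain zs where zs: "mset zs = Z"
    using ex_mset by blast
  define w where "w i = zs ! i" for i
  have len: "length zs = d - 1"
    using Z(1) zs deg_L by (metis size_mset)
  have "L = (\<Prod>x\<leftarrow>zs. [:- x, 1:])"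
    using Z(2) lead zs by (metis mset_map prod_mset_prod_list smult_1_left)
  also have "\<dots> = (\<Prod>i<d - 1. [:- w i, 1:])"
    unfolding prod.list_conv_set_nth by (simp add: w_def len atLeast0LessThan)
  finally have L_eq: "L = (\<Prod>i<d - 1. [:- w i, 1:])" .
  define E where "E = (\<Prod>i<d - 1. 1 - fps_const (w i) * fps_X)"
  have E_eq: "E = Abs_fps A"
  proof (rule fps_ext)
    fix n
    have "E = fps_of_poly (reflect_poly L)"
      unfolding E_def L_eq reflect_poly_prod_linear ..
    then show "E $ n = Abs_fps A $ n"
      using A(2)[of n] d by (auto simp: coeff_reflect_poly deg_L coeff_L)
  qed
  have S_deriv: "fps_deriv E = Abs_fps (\<lambda>n. S (Suc n)) * E"
    by (rule fps_ext) (use rec in \<open>simp add: E_eq fps_mult_nth atLeast0AtMost\<close>)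
  have w_deriv: "fps_deriv E = - E * Abs_fps (\<lambda>n. \<Sum>i<d - 1. w i ^ Suc n)"
    unfolding E_def by (rule fps_deriv_prod_linear) simp
  have "E \<noteq> 0"
    unfolding E_eq using A(1) by (metis fps_nth_Abs_fps fps_zero_nth zero_neq_one)
  moreover have "E * Abs_fps (\<lambda>n. S (Suc n)) = E * - Abs_fps (\<lambda>n. \<Sum>i<d - 1. w i ^ Suc n)"
    using S_deriv w_deriv by (simp add: mult.commute)
  ultimately have "Abs_fps (\<lambda>n. S (Suc n)) = - Abs_fps (\<lambda>n. \<Sum>i<d - 1. w i ^ Suc n)"
    by (simp only: mult_cancel_left simp_thms)
  from arg_cong[OF this, of "\<lambda>F. F $ n" for n] have S: "S (Suc n) = - (\<Sum>i<d - 1. w i ^ Suc n)" for n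
    by simp
  \<comment> \<open>Only the values of \<open>S\<close> at even indices are bounded, so the growth
    argument runs on the squares of the roots. The lower limit \<open>max r0 1\<close> makes
    \<open>2 * r - 1\<close> a true predecessor.\<close>
  have "norm (w a ^ 2) \<le> R ^ 2" if "a < d - 1" for a
  proof (rule power_sum_growth[where A = "{..<d - 1}" and w = "\<lambda>i. w i ^ 2" and a = a])
    fix r assume r: "r \<ge> max r0 1"
    have "(\<Sum>i<d - 1. (w i ^ 2) ^ r) = - S (2 * r)"
      using S[of "2 * r - 1"] r by (simp flip: power_mult)
    then show "norm (\<Sum>i<d - 1. (w i ^ 2) ^ r) \<le> C * (R ^ 2) ^ r"
      using bound[of r] r by simp
  qed (use that R in auto)
  then have w: "norm (w a) \<le> R" if "a < d - 1" for a
    using that R by (auto simp: norm_power intro: power2_le_imp_le)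
  have "norm (S 1) \<le> (\<Sum>i<d - 1. norm (w i))"
    using S[of 0] by (simp add: norm_sum)
  also have "\<dots> \<le> (\<Sum>i<d - 1. R)"
    using w by (intro sum_mono) auto
  finally show ?thesis
    using d by (simp add: of_nat_diff)
qed

text \<open>The majorant is the coefficient of \<open>t ^ n\<close> in
  \<open>(1 - t) ^ (- B)\<close>, which satisfies the same recurrence with every
  \<open>- G i\<close> replaced by \<open>B\<close>. Only the first \<open>k\<close> values of
  \<open>G\<close> are bounded, so the induction stops at \<open>k\<close>.\<close>

lemma norm_elementary_le:
  fixes e G :: "nat \<Rightarrow> complex"
  assumes e0: "e 0 = 1"
    and rec: "\<And>n. of_nat (Suc n) * e (Suc n) = - (\<Sum>i\<le>n. G i * e (n - i))"
    and G: "\<And>i. i < k \<Longrightarrow> norm (G i) \<le> B"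
    and "n \<le> k"
  shows "norm (e n) \<le> (B + real n - 1) gchoose n"
  using \<open>n \<le> k\<close>
proof (induction n rule: less_induct)
  case (less n)
  show ?case
  proof (cases n)
    case 0
    then show ?thesis by (simp add: e0)
  next
    case (Suc m)
    have B: "B \<ge> 0"
      using G[of 0] less.prems Suc by (metis norm_ge_zero order_trans zero_less_Suc less_le_trans)
    have "real (Suc m) * norm (e (Suc m)) = norm (\<Sum>i\<le>m. G i * e (m - i))"
      using arg_cong[OF rec[of m], of norm] by (simp add: norm_mult del: of_nat_Suc)
    also have "\<dots> \<le> (\<Sum>i\<le>m. B * ((B + real (m - i) - 1) gchoose (m - i)))"
    proof (rule sum_norm_le)
      fix i assume "i \<in> {..m}"
      then show "norm (G i * e (m - i)) \<le> B * ((B + real (m - i) - 1) gchoose (m - i))"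
        unfolding norm_mult using less Suc B G by (intro mult_mono less.IH) auto
    qed
    also have "\<dots> = B * (\<Sum>i\<le>m. ((B - 1) + real i) gchoose i)"
      unfolding sum_distrib_left atLeast0AtMost[symmetric]
      by (subst sum.atLeastAtMost_rev) (simp add: algebra_simps)
    also have "\<dots> = B * ((B + real m) gchoose m)"
      by (subst gbinomial_parallel_sum) simp
    also have "\<dots> = real (Suc m) * ((B + real m) gchoose Suc m)"
      using gbinomial_absorb_comp[of "B + real m" m] gbinomial_absorption[of m "B + real m"] by simp
    finally show ?thesis
      by (simp add: Suc del: of_nat_Suc) (simp add: algebra_simps)
  qed
qed

section \<open>Frobenius orbits in the algebraic closure\<close>

lemma size_proots_alg_closed:
  fixes h :: "'a::alg_closed_field poly"
  assumes "h \<noteq> 0"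
  shows "size (proots h) = degree h"
proof -
  obtain Z where Z: "size Z = degree h" "h = smult (lead_coeff h) (\<Prod>x\<in>#Z. [:- x, 1:])"
    using alg_closed_imp_factorization[OF assms] by blast
  have "proots (\<Prod>x\<in>#Z. [:- x, 1:]) = Z" for Z :: "'a multiset"
  proof (induction Z)
    case (add x Z)
    have "(\<Prod>x\<in>#Z. [:- x, 1:]) \<noteq> 0"
      by (auto simp: prod_mset_zero_iff)
    then show ?case
      using add by (simp add: proots_mult del: mult_pCons_left)
  qed simp
  then have "proots h = Z"
    using Z(2) assms by (metis leading_coeff_0_iff proots_smult)
  then show ?thesis
    using Z(1) by simp
qed

lemma sum_order_alg_closed:
  fixes h :: "'a::alg_closed_field poly"
  assumes "h \<noteq> 0" "finite Y" "{x. poly h x = 0} \<subseteq> Y"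
  shows "(\<Sum>x\<in>Y. order x h) = degree h"
proof -
  have "degree h = (\<Sum>x\<in>{x. poly h x = 0}. order x h)"
    using size_proots_alg_closed[OF assms(1)] assms(1) by (simp add: size_multiset_overloaded_eq)
  also have "\<dots> = (\<Sum>x\<in>Y. order x h)"
    using assms by (intro sum.mono_neutral_left) (auto simp: order_root)
  finally show ?thesis ..
qed

lemma prod_linear_dvd:
  fixes H :: "'a::field poly"
  assumes "finite A" "\<And>a. a \<in> A \<Longrightarrow> poly H a = 0"
  shows "(\<Prod>a\<in>A. [:- a, 1:]) dvd H"
  using assms
proof (induction rule: finite_induct)
  case (insert a A)
  then obtain g where g: "H = (\<Prod>a\<in>A. [:- a, 1:]) * g"
    by (auto elim: dvdE)
  have "poly (\<Prod>a\<in>A. [:- a, 1:]) a \<noteq> 0"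
    using insert.hyps by (auto simp: poly_prod)
  then have "poly g a = 0"
    using insert.prems[of a] unfolding g by simp
  then show ?case
    using insert.hyps unfolding g by (simp add: poly_eq_0_iff_dvd mult_dvd_mono mult.commute del: mult_pCons_left mult_pCons_right)
qed simp

text \<open>For \<open>n > 0\<close> this is the subfield with \<open>CARD('p) ^ n\<close> elements;
  for \<open>n = 0\<close> it is the whole closure, hence the positivity assumptions below.\<close>

abbreviation ac_fixed :: "nat \<Rightarrow> 'p::prime_card mod_ring alg_closure set"
  where "ac_fixed n \<equiv> {x. x ^ (CARD('p) ^ n) = x}"

text \<open>The polynomial \<open>X ^ N - X\<close> with \<open>N = CARD('p) ^ n\<close> has
  derivative \<open>- 1\<close>, so its roots are simple and as many as its degree.\<close>

lemma finite_card_ac_fixed: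
  assumes "n > 0"
  shows "finite (ac_fixed n :: 'p::prime_card mod_ring alg_closure set)"
    and "card (ac_fixed n :: 'p mod_ring alg_closure set) = CARD('p) ^ n"
proof -
  define N where "N = CARD('p) ^ n"
  have N: "N > 1"
    using assms prime_gt_1_nat[OF prime_card[where 'a = 'p]] unfolding N_def by (intro one_less_power) auto
  have N0: "of_nat N = (0 :: 'p mod_ring alg_closure)"
    using assms by (simp add: N_def of_nat_eq_0_iff_char_dvd)
  define h where "h = monom (1 :: 'p mod_ring alg_closure) N - monom 1 1"
  have h: "poly h x = x ^ N - x" for x
    by (simp add: h_def poly_monom)
  have deg: "degree h = N"
    unfolding h_def diff_conv_add_uminus using N
    by (subst degree_add_eq_left) (simp_all add: degree_monom_eq)
  have h0: "h \<noteq> 0" using deg N by auto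
  have "pderiv h = - 1"
    using N0 by (simp add: h_def pderiv_diff pderiv_monom one_pCons monom_0)
  then have pd: "poly (pderiv h) x = - 1" for x
    by simp
  have ord: "order x h = 1" if root: "poly h x = 0" for x
  proof (rule ccontr)
    assume "order x h \<noteq> 1"
    then have "2 \<le> order x h"
      using root h0 order_root[of h x] by auto
    then have "[:- x, 1:] ^ 2 dvd h"
      using order_1[of x h] power_le_dvd by blast
    then obtain g where "h = [:- x, 1:] ^ 2 * g"
      by (rule dvdE)
    then have "h = [:- x, 1:] * ([:- x, 1:] * g)"
      by (simp only: power2_eq_square mult.assoc)
    then have "poly (pderiv h) x = 0"
      by (simp add: pderiv_mult del: mult_pCons_left)
    with pd show False by simp
  qed
  have fixed: "ac_fixed n = {x. poly h x = 0}"
    by (auto simp: h N_def)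
  show "finite (ac_fixed n :: 'p mod_ring alg_closure set)"
    unfolding fixed using h0 by (rule poly_roots_finite)
  then show "card (ac_fixed n :: 'p mod_ring alg_closure set) = CARD('p) ^ n"
    using sum_order_alg_closed[OF h0 _ order_refl] ord unfolding fixed
    by (simp add: deg N_def)
qed

lemma ac_fixed_1: "ac_fixed 1 = range (to_ac :: 'p::prime_card mod_ring \<Rightarrow> _)"
proof (rule sym, rule card_subset_eq)
  show "range to_ac \<subseteq> (ac_fixed 1 :: 'p mod_ring alg_closure set)"
    using to_ac_power_card[of _ 1] by auto
  show "card (range (to_ac :: 'p mod_ring \<Rightarrow> _)) = card (ac_fixed 1 :: 'p mod_ring alg_closure set)"
    by (subst finite_card_ac_fixed) (simp_all add: card_image inj_to_ac)
qed (rule finite_card_ac_fixed, simp)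

definition ac_frob :: "'p::prime_card mod_ring alg_closure \<Rightarrow> 'p mod_ring alg_closure"
  where "ac_frob x = x ^ CARD('p)"

interpretation ac_frob: map_poly_inj_idom_divide_hom ac_frob
proof unfold_locales
  fix x y :: "'p::prime_card mod_ring alg_closure"
  show "ac_frob (x + y) = ac_frob x + ac_frob y"
    using ac_power_add[of x y 1] by (simp add: ac_frob_def)
  show "ac_frob (x * y) = ac_frob x * ac_frob y"
    by (simp add: ac_frob_def power_mult_distrib)
  show "x = 0" if "ac_frob x = 0"
    using that by (simp add: ac_frob_def)
qed (auto simp: ac_frob_def power_divide)

lemma ac_power_inj:
  fixes x y :: "'p::prime_card mod_ring alg_closure"
  assumes "x ^ (CARD('p) ^ n) = y ^ (CARD('p) ^ n)"
  shows "x = y"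
proof -
  have "(x - y) ^ (CARD('p) ^ n) = 0"
    by (simp add: ac_power_diff assms)
  then show ?thesis by simp
qed

text \<open>For \<open>x \<in> ac_fixed n\<close> with \<open>n > 0\<close> this is the
  characteristic polynomial of \<open>x\<close> over the prime field; conjugates repeat when the
  period of \<open>x\<close> is a proper divisor of \<open>n\<close>.\<close>

definition orbit_poly :: "nat \<Rightarrow> 'p::prime_card mod_ring alg_closure \<Rightarrow> 'p mod_ring alg_closure poly"
  where "orbit_poly n x = (\<Prod>i<n. [:- (x ^ (CARD('p) ^ i)), 1:])"

lemma orbit_poly_nonzero [simp]: "orbit_poly n x \<noteq> 0"
  by (auto simp: orbit_poly_def)

lemma degree_orbit_poly [simp]: "degree (orbit_poly n x) = n"
  by (simp add: orbit_poly_def degree_prod_eq_sum_degree)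

lemma lead_coeff_orbit_poly: "lead_coeff (orbit_poly n x) = 1"
  unfolding orbit_poly_def lead_coeff_prod by simp

text \<open>Frobenius shifts the conjugates by one step, and the cycle closes after \<open>n\<close>
  steps. Multiplying by the factor of \<open>x\<close> makes both products run over the same
  \<open>n + 1\<close> factors.\<close>

lemma orbit_poly_frob:
  assumes "x \<in> ac_fixed n" "n > 0"
  shows "map_poly ac_frob (orbit_poly n x) = orbit_poly n x"
proof -
  have "map_poly ac_frob (orbit_poly n x) = (\<Prod>i<n. [:- (x ^ (CARD('a) ^ Suc i)), 1:])"
    unfolding orbit_poly_def
    by (simp add: hom_distribs power_mult mult.commute flip: ac_frob_def)
  also have "\<dots> * [:- (x ^ (CARD('a) ^ 0)), 1:] = (\<Prod>i<Suc n. [:- (x ^ (CARD('a) ^ i)), 1:])"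
    by (simp only: prod.lessThan_Suc_shift mult.commute)
  also have "\<dots> = orbit_poly n x * [:- (x ^ (CARD('a) ^ 0)), 1:]"
    using assms by (simp only: prod.lessThan_Suc orbit_poly_def) simp
  finally show ?thesis
    by (simp only: mult_cancel_right) simp
qed

lemma orbit_poly_add:
  assumes "x \<in> ac_fixed e"
  shows "orbit_poly (e + n) x = orbit_poly e x * orbit_poly n x"
proof (induction n)
  case (Suc n)
  have "x ^ (CARD('a) ^ (e + n)) = x ^ (CARD('a) ^ n)"
    using assms by (simp add: power_add power_mult)
  then show ?case
    using Suc by (simp add: orbit_poly_def mult.assoc del: mult_pCons_right)
qed (simp add: orbit_poly_def)

lemma poly_frob_invariant_root:
  fixes H :: "'p::prime_card mod_ring alg_closure poly"
  assumes "map_poly ac_frob H = H" "poly H x = 0"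
  shows "poly H (x ^ (CARD('p) ^ i)) = 0"
proof (induction i)
  case (Suc i)
  define y where "y = x ^ (CARD('p) ^ i)"
  have "poly H (ac_frob y) = poly (map_poly ac_frob H) (ac_frob y)"
    by (simp only: assms(1))
  also have "\<dots> = ac_frob (poly H y)"
    by simp
  finally have "poly H (ac_frob y) = 0"
    using Suc by (simp add: y_def)
  moreover have "ac_frob y = x ^ (CARD('p) ^ Suc i)"
    by (simp add: ac_frob_def y_def mult.commute flip: power_mult)
  ultimately show ?case
    by simp
qed (use assms in simp)

text \<open>The minimal period of \<open>x\<close> under Frobenius contributes one simple factor
  through \<open>x\<close>; dividing it out lowers both sides by one.\<close>
lemma order_eq_card_orbit_poly_dvd:
  fixes H :: "'p::prime_card mod_ring alg_closure poly"
  assumes "H \<noteq> 0" "map_poly ac_frob H = H"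
  shows "order x H = card {n. 0 < n \<and> x \<in> ac_fixed n \<and> orbit_poly n x dvd H}"
  using assms
proof (induction "order x H" arbitrary: H)
  case 0
  have "\<not> orbit_poly n x dvd H" if "n > 0" for n
  proof
    assume "orbit_poly n x dvd H"
    moreover have "poly (orbit_poly n x) x = 0"
      using that by (auto simp: orbit_poly_def poly_prod intro!: bexI[of _ 0])
    ultimately have "poly H x = 0" by auto
    then show False using 0 by (simp add: order_root)
  qed
  then have "{n. 0 < n \<and> x \<in> ac_fixed n \<and> orbit_poly n x dvd H} = {}"
    by blast
  then show ?case using 0(1) by (simp only: card.empty)
next
  case (Suc k)
  define y where "y i = x ^ (CARD('p) ^ i)" for i
  \<comment> \<open>Frobenius is injective, so a repetition among the iterates means that
    \<open>x\<close> itself is periodic.\<close>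
  have fixed: "x \<in> ac_fixed (j - i)" if "y i = y j" "i < j" for i j
  proof -
    have "x ^ (CARD('p) ^ i) = (x ^ (CARD('p) ^ (j - i))) ^ (CARD('p) ^ i)"
      using that by (simp add: y_def flip: power_mult power_add)
    then show ?thesis
      using ac_power_inj[of x i "x ^ (CARD('p) ^ (j - i))"] by simp
  qed
  have root: "poly H x = 0"
    using Suc.hyps(2) by (simp add: order_root)
  then have roots: "poly H (y i) = 0" for i
    unfolding y_def by (rule poly_frob_invariant_root[OF Suc.prems(2)])
  have "\<not> inj y"
    using finite_subset[of "range y" "{x. poly H x = 0}"] roots poly_roots_finite[OF Suc.prems(1)]
    by (auto dest: finite_imageD)
  then obtain i j where "y i = y j" "i < j"
    by (metis injI linorder_neqE_nat)
  then have ex: "\<exists>n. n > 0 \<and> x \<in> ac_fixed n"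
    using fixed by (metis zero_less_diff)
  define e where "e = (LEAST n. n > 0 \<and> x \<in> ac_fixed n)"
  have e: "e > 0" "x \<in> ac_fixed e"
    using LeastI_ex[OF ex] by (auto simp: e_def)
  have e_le: "e \<le> n" if "n > 0" "x \<in> ac_fixed n" for n
    unfolding e_def using that by (intro Least_le) auto
  have inj: "inj_on y {..<e}"
  proof (rule linorder_inj_onI)
    fix i j assume "i < j" "i \<in> {..<e}" "j \<in> {..<e}"
    then show "y i \<noteq> y j"
      using fixed[of i j] e_le[of "j - i"] by auto
  qed auto
  have orbit_e: "orbit_poly e x = (\<Prod>a\<in>y ` {..<e}. [:- a, 1:])"
    unfolding orbit_poly_def prod.reindex[OF inj] by (simp add: y_def)
  then have "orbit_poly e x dvd H"
    using prod_linear_dvd[of "y ` {..<e}" H] roots by auto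
  then obtain H' where H': "H = orbit_poly e x * H'"
    by (elim dvdE)
  have H'0: "H' \<noteq> 0" using H' Suc.prems by auto
  have "orbit_poly e x * map_poly ac_frob H' = orbit_poly e x * H'"
    using Suc.prems(2) e unfolding H' by (simp add: orbit_poly_frob hom_distribs)
  then have inv: "map_poly ac_frob H' = H'"
    by simp
  have "proots (orbit_poly e x) = mset_set (y ` {..<e})"
    unfolding orbit_e by (subst proots_prod) auto
  then have "order x (orbit_poly e x) = 1"
    using e by (auto simp: count_mset_set' y_def image_iff simp flip: count_proots intro: bexI[of _ 0])
  then have ord: "order x H = Suc (order x H')"
    using order_mult[of "orbit_poly e x" H' x] Suc.prems(1) H' by simp
  let ?N = "\<lambda>H. {n. 0 < n \<and> x \<in> ac_fixed n \<and> orbit_poly n x dvd H}"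
  \<comment> \<open>The lengths counted for \<open>H\<close> are \<open>e\<close> and
    \<open>e + m\<close> for each length \<open>m\<close> counted for \<open>H'\<close>; minimality
    of \<open>e\<close> excludes anything smaller.\<close>
  have "?N H = insert e ((+) e ` ?N H')"
  proof (rule Set.set_eqI)
    fix n
    show "n \<in> ?N H \<longleftrightarrow> n \<in> insert e ((+) e ` ?N H')"
    proof (cases "n > e")
      case True
      then obtain m where m: "n = e + m" "m > 0"
        by (metis less_imp_add_positive)
      have "x \<in> ac_fixed n \<longleftrightarrow> x \<in> ac_fixed m"
        using e(2) by (simp add: m power_add power_mult)
      moreover have "orbit_poly n x dvd H \<longleftrightarrow> orbit_poly m x dvd H'"
        unfolding H' m orbit_poly_add[OF e(2)] by simp
      ultimately show ?thesis
        using m by auto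
    next
      case False
      then have "n \<in> ?N H \<longleftrightarrow> n = e"
        using e e_le[of n] H' by auto
      then show ?thesis using False by auto
    qed
  qed
  moreover have "finite (?N H')"
  proof (rule finite_subset)
    show "?N H' \<subseteq> {..degree H'}"
      using H'0 dvd_imp_degree_le[of "orbit_poly _ x" H'] by fastforce
  qed simp
  moreover have "e \<notin> (+) e ` ?N H'" by auto
  ultimately have "card (?N H) = Suc (card (?N H'))"
    by (simp add: card_image)
  moreover have "order x H' = card (?N H')"
    using Suc.hyps(1)[of H'] Suc.hyps(2) ord H'0 inv by simp
  ultimately show ?case using ord by simp
qed

section \<open>Power sums of roots as formal power series\<close>

definition rev_fps :: "'a::field poly \<Rightarrow> 'a fps"
  where "rev_fps h = fps_of_poly (reflect_poly h)"

text \<open>For monic \<open>h\<close>, coefficient \<open>n\<close> is the sum of the \<open>(n +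
  1)\<close>-st powers of the roots.\<close>
definition newton_fps :: "'a::field poly \<Rightarrow> 'a fps"
  where "newton_fps h = - fps_deriv (rev_fps h) * inverse (rev_fps h)"

lemma rev_fps_nth: "rev_fps h $ n = (if n \<le> degree h then coeff h (degree h - n) else 0)"
  by (auto simp: rev_fps_def coeff_reflect_poly)

lemma rev_fps_mult: "rev_fps (g * h) = rev_fps g * rev_fps h"
  by (simp add: rev_fps_def reflect_poly_mult fps_of_poly_mult)

lemma newton_fps_times:
  assumes "h \<noteq> 0"
  shows "newton_fps h * rev_fps h = - fps_deriv (rev_fps h)"
proof -
  have "inverse (rev_fps h) * rev_fps h = 1"
    by (rule inverse_mult_eq_1) (use assms in \<open>simp add: rev_fps_nth\<close>)
  then show ?thesis
    by (simp add: newton_fps_def mult.assoc)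
qed

lemma rev_fps_nonzero: "h \<noteq> 0 \<Longrightarrow> rev_fps h \<noteq> 0"
  by (auto simp: rev_fps_def)

lemma newton_fps_eqI:
  assumes "h \<noteq> 0" "G * rev_fps h = - fps_deriv (rev_fps h)"
  shows "newton_fps h = G"
  using newton_fps_times[OF assms(1)] assms(2) rev_fps_nonzero[OF assms(1)]
  by (metis mult_cancel_right)

lemma newton_fps_mult:
  assumes "g \<noteq> 0" "h \<noteq> 0"
  shows "newton_fps (g * h) = newton_fps g + newton_fps h"
proof (rule newton_fps_eqI)
  have "(newton_fps g + newton_fps h) * (rev_fps g * rev_fps h) =
      (newton_fps g * rev_fps g) * rev_fps h + rev_fps g * (newton_fps h * rev_fps h)"
    by (simp add: algebra_simps)
  then show "(newton_fps g + newton_fps h) * rev_fps (g * h) = - fps_deriv (rev_fps (g * h))"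
    using assms by (simp add: rev_fps_mult newton_fps_times algebra_simps)
qed (use assms in simp)

lemma newton_fps_prod_linear:
  fixes w :: "'i \<Rightarrow> 'a::field"
  assumes "finite A"
  shows "newton_fps (\<Prod>i\<in>A. [:- w i, 1:]) = Abs_fps (\<lambda>n. \<Sum>i\<in>A. w i ^ Suc n)"
  using fps_deriv_prod_linear[OF assms, of w]
  by (intro newton_fps_eqI) (auto simp: rev_fps_def reflect_poly_prod_linear mult.commute assms)

lemma newton_fps_map_to_ac:
  fixes h :: "'a::field poly"
  assumes "h \<noteq> 0"
  shows "newton_fps (map_poly to_ac h) $ n = to_ac (newton_fps h $ n)"
proof -
  define m :: "'a fps \<Rightarrow> 'a alg_closure fps" where "m F = Abs_fps (\<lambda>n. to_ac (F $ n))" for F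
  have rev: "rev_fps (map_poly to_ac h) = m (rev_fps h)"
    by (rule fps_ext) (simp add: rev_fps_nth m_def)
  have mult: "m (F * G) = m F * m G" for F G
    by (rule fps_ext) (simp add: m_def fps_mult_nth to_ac_sum)
  have "m (newton_fps h) * m (rev_fps h) = m (- fps_deriv (rev_fps h))"
    using newton_fps_times[OF assms] by (simp flip: mult)
  also have "\<dots> = - fps_deriv (m (rev_fps h))"
    by (rule fps_ext) (simp add: m_def)
  finally have "newton_fps (map_poly to_ac h) = m (newton_fps h)"
    using assms by (intro newton_fps_eqI) (simp_all add: rev)
  then show ?thesis by (simp add: m_def)
qed

text \<open>For monic \<open>h\<close>, this is the sum of \<open>f\<close> over the roots of
  \<open>h\<close> in an algebraic closure; Newton's identities express it in the base
  field.\<close>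
definition root_sum :: "'a::field poly \<Rightarrow> 'a poly \<Rightarrow> 'a"
  where "root_sum f h = coeff f 0 * of_nat (degree h) +
    (\<Sum>j<degree f. coeff f (Suc j) * newton_fps h $ j)"

lemma root_sum_mult:
  assumes "g \<noteq> 0" "h \<noteq> 0"
  shows "root_sum f (g * h) = root_sum f g + root_sum f h"
  using assms
  by (simp add: root_sum_def degree_mult_eq newton_fps_mult sum.distrib algebra_simps)

lemma root_sum_1: "root_sum f 1 = 0"
proof -
  have "newton_fps (1 :: 'a poly) = 0"
    by (rule newton_fps_eqI) (simp_all add: rev_fps_def)
  then show ?thesis by (simp add: root_sum_def)
qed

lemma root_sum_prod_linear:
  assumes "finite A"
  shows "root_sum f (\<Prod>i\<in>A. [:- w i, 1:]) = (\<Sum>i\<in>A. poly f (w i))"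
proof -
  have "poly f x = coeff f 0 + (\<Sum>j<degree f. coeff f (Suc j) * x ^ Suc j)" for x
    unfolding poly_altdef lessThan_Suc_atMost[symmetric] by (subst sum.lessThan_Suc_shift) simp
  then have "(\<Sum>i\<in>A. poly f (w i)) = coeff f 0 * of_nat (card A) +
      (\<Sum>i\<in>A. \<Sum>j<degree f. coeff f (Suc j) * w i ^ Suc j)"
    by (simp add: sum.distrib mult.commute)
  also have "\<dots> = coeff f 0 * of_nat (card A) +
      (\<Sum>j<degree f. coeff f (Suc j) * (\<Sum>i\<in>A. w i ^ Suc j))"
    unfolding sum_distrib_left by (subst sum.swap) simp
  finally show ?thesis
    by (simp add: root_sum_def newton_fps_prod_linear[OF assms] degree_prod_eq_sum_degree)
qed

lemma root_sum_map_to_ac: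
  assumes "h \<noteq> 0"
  shows "root_sum (map_poly to_ac f) (map_poly to_ac h) = to_ac (root_sum f h)"
  using assms by (simp add: root_sum_def newton_fps_map_to_ac hom_distribs to_ac_sum)

text \<open>The monomial changes the reversed series only at \<open>X ^ d\<close>, where
  \<open>d = degree f\<close>. By Newton's identities the first \<open>d - 1\<close> power sums stay
  the same and the \<open>d\<close>-th moves by \<open>- d * u\<close>; it enters with the leading
  coefficient of \<open>f\<close>.\<close>

lemma root_sum_add_monom:
  fixes f h :: "'a::field poly"
  assumes "lead_coeff h = 1" "degree f \<le> degree h" "degree f > 0"
  shows "root_sum f (h + monom u (degree h - degree f)) =
    root_sum f h - of_nat (degree f) * lead_coeff f * u"
proof -
  define d where "d = degree f"
  define h' where "h' = h + monom u (degree h - d)"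
  have "degree (monom u (degree h - d)) < degree h"
    using assms degree_monom_le[of u "degree h - d"] unfolding d_def by linarith
  then have deg: "degree h' = degree h"
    unfolding h'_def by (rule degree_add_eq_left)
  have h0: "h \<noteq> 0" "h' \<noteq> 0"
    using assms deg by auto
  have coeff': "coeff h' k = coeff h k + (if k = degree h - d then u else 0)" for k
    by (simp add: h'_def)
  have d: "d \<le> degree h"
    using assms by (simp add: d_def)
  have rev': "rev_fps h' = rev_fps h + fps_const u * fps_X ^ d"
  proof (rule fps_ext)
    fix n
    have "n \<le> degree h \<Longrightarrow> degree h - n = degree h - d \<longleftrightarrow> n = d"
      using d by linarith
    then show "rev_fps h' $ n = (rev_fps h + fps_const u * fps_X ^ d) $ n"
      using d by (simp add: rev_fps_nth deg coeff' fps_X_power_nth)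
  qed
  define c where "c = fps_const (of_nat d * u)"
  \<comment> \<open>\<open>W\<close> is obtained by solving the equation of
    \<open>newton_fps h'\<close> with the ansatz \<open>newton_fps h + fps_X ^ (d - 1) * W\<close>;
    only its constant term reaches the coefficients below \<open>d\<close>.\<close>
  define W where "W = (- c - newton_fps h * fps_const u * fps_X) * inverse (rev_fps h')"
  have inv: "inverse (rev_fps h') * rev_fps h' = 1"
    by (rule inverse_mult_eq_1) (use h0 in \<open>simp add: rev_fps_nth\<close>)
  obtain e where e: "d = Suc e"
    using assms(3) by (cases d) (auto simp: d_def)
  have "fps_deriv (rev_fps h') = fps_deriv (rev_fps h) + c * fps_X ^ e"
    unfolding rev' e by (rule fps_ext) (simp add: c_def e fps_X_power_nth del: power_Suc)
  moreover have "(newton_fps h + fps_X ^ e * W) * rev_fps h' =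
      newton_fps h * rev_fps h + newton_fps h * fps_const u * fps_X ^ d +
      fps_X ^ e * (- c - newton_fps h * fps_const u * fps_X)"
  proof -
    have "W * rev_fps h' = - c - newton_fps h * fps_const u * fps_X"
      by (simp add: W_def mult.assoc inv)
    then have "(newton_fps h + fps_X ^ e * W) * rev_fps h' = newton_fps h * rev_fps h' +
      fps_X ^ e * (- c - newton_fps h * fps_const u * fps_X)"
      by (simp add: distrib_right mult.assoc)
    then show ?thesis
      by (simp add: rev' distrib_left mult.assoc)
  qed
  ultimately have "newton_fps h' = newton_fps h + fps_X ^ e * W"
    using newton_fps_times[OF h0(1)]
    by (intro newton_fps_eqI[OF h0(2)]) (simp add: e algebra_simps)
  then have N: "newton_fps h' $ j = newton_fps h $ j + (if j = e then W $ 0 else 0)" if "j < d" for j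
    using that e by (auto simp: fps_X_power_mult_nth)
  have "rev_fps h' $ 0 = 1"
    using assms(1) by (simp add: rev' e rev_fps_nth)
  then have "W $ 0 = - (of_nat d * u)"
    by (simp add: W_def c_def)
  then have "(\<Sum>j<d. coeff f (Suc j) * newton_fps h' $ j) =
      (\<Sum>j<d. coeff f (Suc j) * newton_fps h $ j) - coeff f d * (of_nat d * u)"
    by (simp add: e N[unfolded e] right_diff_distrib)
  then show ?thesis
    by (simp add: root_sum_def deg d_def[symmetric] h'_def[symmetric] mult_ac)
qed


section \<open>Orbit polynomials over the prime field and monic polynomials\<close>

definition base_orbit_poly :: "nat \<Rightarrow> 'p::prime_card mod_ring alg_closure \<Rightarrow> 'p mod_ring poly"
  where "base_orbit_poly n x = map_poly of_ac (orbit_poly n x)"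

text \<open>Invariance under Frobenius puts every coefficient in \<open>ac_fixed 1\<close>, the
  image of the prime field, where \<open>of_ac\<close> inverts \<open>to_ac\<close>.\<close>

lemma map_poly_base_orbit_poly:
  assumes "x \<in> ac_fixed n" "n > 0"
  shows "map_poly to_ac (base_orbit_poly n x) = orbit_poly n x"
proof (rule poly_eqI)
  fix k
  have "ac_frob (coeff (orbit_poly n x) k) = coeff (map_poly ac_frob (orbit_poly n x)) k"
    by simp
  then have "coeff (orbit_poly n x) k \<in> ac_fixed 1"
    by (simp add: orbit_poly_frob[OF assms]) (simp add: ac_frob_def)
  then have "coeff (orbit_poly n x) k \<in> range to_ac"
    by (simp only: ac_fixed_1)
  then show "coeff (map_poly to_ac (base_orbit_poly n x)) k = coeff (orbit_poly n x) k"
    by (simp add: base_orbit_poly_def coeff_map_poly to_ac_of_ac)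
qed

definition monic_polys :: "nat \<Rightarrow> 'a::field poly set"
  where "monic_polys m = {h. degree h = m \<and> lead_coeff h = 1}"

lemma base_orbit_poly_monic:
  assumes "x \<in> ac_fixed n" "n > 0"
  shows "base_orbit_poly n x \<in> monic_polys n"
proof -
  have "degree (map_poly to_ac (base_orbit_poly n x)) = n"
    "lead_coeff (map_poly to_ac (base_orbit_poly n x)) = 1"
    using lead_coeff_orbit_poly[of n x] by (simp_all only: map_poly_base_orbit_poly[OF assms] degree_orbit_poly)
  then show ?thesis
    by (simp add: monic_polys_def)
qed

lemma base_orbit_poly_dvd_iff:
  assumes "x \<in> ac_fixed n" "n > 0"
  shows "base_orbit_poly n x dvd h \<longleftrightarrow> orbit_poly n x dvd map_poly to_ac h"
  using to_ac_hom.hom_dvd_iff[of "base_orbit_poly n x" h]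
  by (simp add: map_poly_base_orbit_poly[OF assms])

text \<open>The roots of the orbit polynomial are the conjugates of \<open>x\<close>, and
  \<open>f\<close> commutes with Frobenius. Thus \<open>root_sum\<close> gives the trace as an
  element of the prime field itself, where characters apply.\<close>

lemma root_sum_base_orbit_poly:
  assumes "x \<in> ac_fixed n" "n > 0"
  shows "to_ac (root_sum f (base_orbit_poly n x)) = ac_trace n (poly (map_poly to_ac f) x)"
proof -
  have "base_orbit_poly n x \<noteq> 0"
    using base_orbit_poly_monic[OF assms] by (auto simp: monic_polys_def)
  then have "to_ac (root_sum f (base_orbit_poly n x)) =
      root_sum (map_poly to_ac f) (orbit_poly n x)"
    by (simp add: root_sum_map_to_ac[symmetric] map_poly_base_orbit_poly[OF assms])
  also have "\<dots> = (\<Sum>i<n. poly (map_poly to_ac f) (x ^ (CARD('a) ^ i)))"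
    unfolding orbit_poly_def by (rule root_sum_prod_linear) simp
  finally show ?thesis
    by (simp add: ac_trace_def poly_ac_power)
qed

lemma finite_monic_polys [simp]: "finite (monic_polys m :: 'a::{field,finite} poly set)"
proof (rule finite_imageD)
  show "finite (coeffs ` (monic_polys m :: 'a poly set))"
  proof (rule finite_subset)
    show "coeffs ` monic_polys m \<subseteq> {xs :: 'a list. set xs \<subseteq> UNIV \<and> length xs \<le> Suc m}"
      by (auto simp: monic_polys_def) (simp add: degree_eq_length_coeffs)
  qed (rule finite_lists_length_le, simp)
  show "inj_on coeffs (monic_polys m :: 'a poly set)"
    by (simp add: inj_on_def coeffs_eq_iff)
qed

lemma bij_betw_monic_multiples:
  assumes "g \<in> monic_polys n" "n \<le> m"
  shows "bij_betw ((*) g) (monic_polys (m - n)) {h \<in> monic_polys m. g dvd h}"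
proof -
  have g: "g \<noteq> 0" "degree g = n" "lead_coeff g = 1"
    using assms by (auto simp: monic_polys_def)
  show ?thesis
  proof (rule bij_betw_imageI)
    show "inj_on ((*) g) (monic_polys (m - n))"
      using g by (auto simp: inj_on_def)
    show "(*) g ` monic_polys (m - n) = {h \<in> monic_polys m. g dvd h}"
    proof safe
      fix h :: "'a poly" assume h: "h \<in> monic_polys (m - n)"
      then have "h \<noteq> 0" by (auto simp: monic_polys_def)
      then have "degree (g * h) = n + degree h" "lead_coeff (g * h) = lead_coeff h"
        using g degree_mult_eq[OF g(1) \<open>h \<noteq> 0\<close>] lead_coeff_mult[of g h] by simp_all
      then show "g * h \<in> monic_polys m"
        using h assms(2) by (auto simp: monic_polys_def)
    next
      fix h assume h: "h \<in> monic_polys m" "g dvd h"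
      obtain k where k: "h = g * k" using h(2) by (rule dvdE)
      then have "k \<noteq> 0" using h by (auto simp: monic_polys_def)
      then have "degree h = n + degree k" "lead_coeff h = lead_coeff k"
        using g degree_mult_eq[OF g(1) \<open>k \<noteq> 0\<close>] lead_coeff_mult[of g k] by (simp_all add: k)
      then have "k \<in> monic_polys (m - n)"
        using h by (auto simp: monic_polys_def)
      then show "h \<in> (*) g ` monic_polys (m - n)"
        using k by blast
    qed simp
  qed
qed

text \<open>Double counting of pairs \<open>(n, x)\<close>: for fixed \<open>x\<close> the number of
  admissible \<open>n\<close> is the order of \<open>x\<close> as a root of \<open>h\<close>, and
  these orders add up to the degree.\<close>

lemma card_orbit_poly_factors:
  fixes h :: "'p::prime_card mod_ring poly"
  assumes "h \<in> monic_polys m"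
  shows "(\<Sum>n\<in>{1..m}. card {x \<in> ac_fixed n. base_orbit_poly n x dvd h}) = m"
proof -
  define H where "H = map_poly to_ac h"
  have h0: "h \<noteq> 0" "degree h = m"
    using assms by (auto simp: monic_polys_def)
  have H: "H \<noteq> 0" "degree H = m"
    using h0 by (auto simp: H_def)
  have inv: "map_poly ac_frob H = H"
    by (rule poly_eqI) (use to_ac_power_card[of _ 1] in \<open>simp add: H_def ac_frob_def\<close>)
  define Y where "Y = {x. poly H x = 0} \<union> (\<Union>n\<in>{1..m}. ac_fixed n)"
  have finY: "finite Y"
    unfolding Y_def using H(1) by (auto intro!: poly_roots_finite finite_card_ac_fixed(1))
  define P where "P n x \<longleftrightarrow> x \<in> ac_fixed n \<and> orbit_poly n x dvd H" for n x
  have "(\<Sum>n\<in>{1..m}. card {x \<in> ac_fixed n. base_orbit_poly n x dvd h}) =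
      (\<Sum>n\<in>{1..m}. card {x \<in> Y. P n x})"
  proof (intro sum.cong refl arg_cong[where f = card])
    fix n assume "n \<in> {1..m}"
    then show "{x \<in> ac_fixed n. base_orbit_poly n x dvd h} = {x \<in> Y. P n x}"
      by (auto simp: Y_def P_def H_def base_orbit_poly_dvd_iff)
  qed
  also have "\<dots> = (\<Sum>n\<in>{1..m}. \<Sum>x\<in>Y. if P n x then 1 else 0)"
    using finY by (simp add: sum.If_cases Int_def)
  also have "\<dots> = (\<Sum>x\<in>Y. \<Sum>n\<in>{1..m}. if P n x then 1 else 0)"
    by (rule sum.swap)
  also have "\<dots> = (\<Sum>x\<in>Y. card {n \<in> {1..m}. P n x})"
    by (simp add: sum.If_cases Int_def)
  also have "\<dots> = (\<Sum>x\<in>Y. order x H)"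
  proof (intro sum.cong refl)
    fix x
    have "{n \<in> {1..m}. P n x} = {n. 0 < n \<and> x \<in> ac_fixed n \<and> orbit_poly n x dvd H}"
      using H dvd_imp_degree_le[of "orbit_poly _ x" H] by (fastforce simp: P_def)
    then show "card {n \<in> {1..m}. P n x} = order x H"
      by (simp only: order_eq_card_orbit_poly_dvd[OF H(1) inv])
  qed
  also have "\<dots> = m"
    using sum_order_alg_closed[OF H(1) finY] H(2) by (auto simp: Y_def)
  finally show ?thesis .
qed

section \<open>The L-function and the Weil bound\<close>

definition add_char :: "'p::prime_card mod_ring \<Rightarrow> complex"
  where "add_char x = cis (2 * pi * (of_int (to_int_mod_ring x) / CARD('p)))"

lemma norm_add_char [simp]: "norm (add_char x) = 1"
  by (simp add: add_char_def)

lemma add_char_0 [simp]: "add_char 0 = 1"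
  by (simp add: add_char_def)

lemma add_char_add: "add_char (x + y) = add_char x * add_char (y :: 'p::prime_card mod_ring)"
proof -
  define N where "N = to_int_mod_ring x + to_int_mod_ring y"
  have "real_of_int (N mod CARD('p)) / CARD('p) = of_int N / CARD('p) - of_int (N div CARD('p))"
  proof -
    have "N = int CARD('p) * (N div CARD('p)) + N mod CARD('p)"
      by simp
    from arg_cong[OF this, of real_of_int]
    have "real_of_int N = real CARD('p) * of_int (N div CARD('p)) + of_int (N mod CARD('p))"
      by (simp only: of_int_add of_int_mult of_int_of_nat_eq)
    then have "real_of_int (N mod CARD('p)) = of_int N - real CARD('p) * of_int (N div CARD('p))"
      by linarith
    then show ?thesis
      by (simp only: diff_divide_distrib) simp
  qed
  then have "add_char (x + y) =
      cis (2 * pi * (of_int N / CARD('p)) - 2 * pi * of_int (N div CARD('p)))"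
    by (simp add: add_char_def to_int_mod_ring_add N_def ring_distribs)
  also have "\<dots> = cis (2 * pi * (of_int N / CARD('p)))"
    by (simp flip: cis_divide)
  finally show ?thesis
    by (simp add: add_char_def cis_mult N_def ring_distribs add_divide_distrib)
qed

lemma add_char_sum: "add_char (\<Sum>x\<in>A. g x) = (\<Prod>x\<in>A. add_char (g x))"
  by (induction A rule: infinite_finite_induct) (auto simp: add_char_add)

lemma add_char_neq_1:
  fixes x :: "'p::prime_card mod_ring"
  assumes "x \<noteq> 0"
  shows "add_char x \<noteq> 1"
proof
  assume "add_char x = 1"
  then have "cos (2 * pi * (of_int (to_int_mod_ring x) / CARD('p))) = 1"
    by (simp add: add_char_def complex_eq_iff)
  then obtain k :: int where "2 * pi * (of_int (to_int_mod_ring x) / CARD('p)) = of_int k * 2 * pi"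
    unfolding cos_one_2pi_int by blast
  then have "real_of_int (to_int_mod_ring x) = of_int (k * int CARD('p))"
    by (simp add: field_simps)
  then have k: "to_int_mod_ring x = k * int CARD('p)"
    by linarith
  have "to_int_mod_ring x \<in> {0..<int CARD('p)}"
    using range_to_int_mod_ring[where 'a = 'p] by auto
  then have "to_int_mod_ring x = 0"
    using k by (metis atLeastLessThan_iff mod_mult_self2_is_0 mod_pos_pos_trivial)
  then show False using assms by simp
qed

text \<open>Replacing \<open>a\<close> by \<open>a + 1\<close> permutes the summands and multiplies
  the sum by \<open>add_char x\<close>, which differs from \<open>1\<close> unless
  \<open>x = 0\<close>.\<close>

lemma sum_add_char:
  fixes x :: "'p::prime_card mod_ring"
  shows "(\<Sum>a\<in>UNIV. add_char (a * x)) = (if x = 0 then of_nat CARD('p) else 0)"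
proof (cases "x = 0")
  case False
  have "(\<Sum>a\<in>UNIV. add_char (a * x)) = (\<Sum>a\<in>UNIV. add_char ((a + 1) * x))"
    by (rule sum.reindex_bij_witness[of _ "\<lambda>a. a + 1" "\<lambda>a. a - 1"]) auto
  also have "\<dots> = add_char x * (\<Sum>a\<in>UNIV. add_char (a * x))"
    by (simp add: distrib_right add_char_add sum_distrib_left mult.commute[of "add_char x"])
  finally show ?thesis
    using add_char_neq_1[OF False] False by simp
qed simp

text \<open>These are the coefficients of the L-function attached to
  \<open>h \<mapsto> add_char (root_sum f h)\<close>, which is multiplicative on monic polynomials
  by \<open>root_sum_mult\<close>.\<close>

definition L_coeff :: "'p::prime_card mod_ring poly \<Rightarrow> nat \<Rightarrow> complex"
  where "L_coeff f m = (\<Sum>h\<in>monic_polys m. add_char (root_sum f h))"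

text \<open>For \<open>n > 0\<close> this is the sum of \<open>add_char\<close> at the trace of
  \<open>f(x)\<close> over the field with \<open>CARD('p) ^ n\<close> elements.\<close>

definition ext_char_sum :: "'p::prime_card mod_ring poly \<Rightarrow> nat \<Rightarrow> complex"
  where "ext_char_sum f n = (\<Sum>x\<in>ac_fixed n. add_char (root_sum f (base_orbit_poly n x)))"

lemma L_coeff_0: "L_coeff f 0 = 1"
proof -
  have "monic_polys 0 = {1 :: 'a mod_ring poly}"
    by (auto simp: monic_polys_def elim!: degree_eq_zeroE)
  then show ?thesis
    by (simp add: L_coeff_def root_sum_1)
qed

text \<open>Adding a suitable multiple of \<open>X ^ (m - d)\<close> permutes the monic polynomials
  of degree \<open>m\<close> and multiplies every summand by \<open>add_char 1\<close>, which is not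
  \<open>1\<close>. The bound on \<open>degree f\<close> makes \<open>d\<close> invertible in the
  field.\<close>

lemma L_coeff_eq_0:
  fixes f :: "'p::prime_card mod_ring poly"
  assumes "0 < degree f" "degree f < CARD('p)" "degree f \<le> m"
  shows "L_coeff f m = 0"
proof -
  define d where "d = degree f"
  define c where "c = of_nat d * lead_coeff f"
  have "(of_nat d :: 'p mod_ring) \<noteq> 0"
    using assms by (auto simp: of_nat_eq_0_iff_char_dvd d_def dest: dvd_imp_le)
  then have c: "c \<noteq> 0"
    using assms by (auto simp: c_def)
  \<comment> \<open>Chosen so that \<open>root_sum f\<close> rises by exactly
    \<open>1\<close>.\<close>
  define u where "u = - 1 / c"
  define t where "t h = h + monom u (m - d)" for h
  have deg: "degree (monom v (m - d)) < m" for v :: "'p mod_ring"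
    using assms degree_monom_le[of v "m - d"] unfolding d_def by linarith
  have monic: "h + monom v (m - d) \<in> monic_polys m" if "h \<in> monic_polys m"
    for h :: "'p mod_ring poly" and v
  proof -
    have "degree (h + monom v (m - d)) = m"
      using that deg[of v] by (subst degree_add_eq_left) (auto simp: monic_polys_def)
    moreover have "coeff (monom v (m - d)) m = 0"
      using deg[of v] by (rule coeff_eq_0)
    ultimately show ?thesis
      using that by (auto simp: monic_polys_def)
  qed
  have "L_coeff f m = (\<Sum>h\<in>monic_polys m. add_char (root_sum f (t h)))"
    unfolding L_coeff_def t_def
    using monic monic[of _ "- u"]
    by (intro sum.reindex_bij_witness[of _ "\<lambda>h. h + monom u (m - d)" "\<lambda>h. h + monom (- u) (m - d)"])
      (auto simp: minus_monom[symmetric])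
  also have "\<dots> = (\<Sum>h\<in>monic_polys m. add_char (1 :: 'p mod_ring) * add_char (root_sum f h))"
  proof (rule sum.cong[OF refl])
    fix h :: "'p mod_ring poly" assume "h \<in> monic_polys m"
    then have "root_sum f (t h) = root_sum f h - c * u"
      using root_sum_add_monom[of h f u] assms unfolding monic_polys_def t_def c_def d_def by auto
    also have "\<dots> = 1 + root_sum f h"
      using c by (simp add: u_def)
    finally show "add_char (root_sum f (t h)) = add_char (1 :: 'p mod_ring) * add_char (root_sum f h)"
      by (simp add: add_char_add)
  qed
  also have "\<dots> = add_char (1 :: 'p mod_ring) * L_coeff f m"
    by (simp add: L_coeff_def sum_distrib_left)
  finally show ?thesis
    using add_char_neq_1[of "1 :: 'p mod_ring"] by simp
qed

text \<open>This is the logarithmic derivative of the L-function: the von Mangoldt weight of an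
  Euler factor is spread over its roots, so that \<open>deg h\<close> counts the pairs \<open>(n,
  x)\<close> with \<open>base_orbit_poly n x\<close> dividing \<open>h\<close>.\<close>
lemma L_coeff_recurrence:
  fixes f :: "'p::prime_card mod_ring poly"
  shows "of_nat (Suc m) * L_coeff f (Suc m) = (\<Sum>n\<le>m. ext_char_sum f (Suc n) * L_coeff f (m - n))"
proof -
  let ?M = "monic_polys (Suc m) :: 'p mod_ring poly set"
  let ?\<chi> = "\<lambda>h. add_char (root_sum f h)"
  have "of_nat (Suc m) * L_coeff f (Suc m) =
      (\<Sum>h\<in>?M. (\<Sum>n\<in>{1..Suc m}. of_nat (card {x \<in> ac_fixed n. base_orbit_poly n x dvd h})) * ?\<chi> h)"
    unfolding L_coeff_def sum_distrib_left of_nat_sum[symmetric]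
    by (intro sum.cong refl) (simp only: card_orbit_poly_factors)
  also have "\<dots> = (\<Sum>h\<in>?M. \<Sum>n\<in>{1..Suc m}. \<Sum>x\<in>ac_fixed n.
      if base_orbit_poly n x dvd h then ?\<chi> h else 0)"
    unfolding sum_distrib_right
    by (intro sum.cong refl) (simp add: finite_card_ac_fixed(1) sum.If_cases Int_def)
  also have "\<dots> = (\<Sum>n\<in>{1..Suc m}. \<Sum>x\<in>ac_fixed n. \<Sum>h\<in>?M.
      if base_orbit_poly n x dvd h then ?\<chi> h else 0)"
    by (subst sum.swap, intro sum.cong refl, rule sum.swap)
  also have "\<dots> = (\<Sum>n\<in>{1..Suc m}. \<Sum>x\<in>ac_fixed n. ?\<chi> (base_orbit_poly n x) * L_coeff f (Suc m - n))"
  proof (intro sum.cong refl)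
    fix n and x :: "'p mod_ring alg_closure"
    assume n: "n \<in> {1..Suc m}" and x: "x \<in> ac_fixed n"
    let ?g = "base_orbit_poly n x"
    have g: "?g \<in> monic_polys n"
      using n x by (intro base_orbit_poly_monic) auto
    have "(\<Sum>h\<in>?M. if ?g dvd h then ?\<chi> h else 0) = (\<Sum>h\<in>{h \<in> ?M. ?g dvd h}. ?\<chi> h)"
      by (simp add: sum.If_cases Int_def)
    \<comment> \<open>The monic multiples of \<open>?g\<close> correspond to their cofactors, and
      the character is multiplicative.\<close>
    also have "\<dots> = (\<Sum>k\<in>monic_polys (Suc m - n). ?\<chi> (?g * k))"
      using n g by (intro sum.reindex_bij_betw[symmetric] bij_betw_monic_multiples) auto
    also have "\<dots> = (\<Sum>k\<in>monic_polys (Suc m - n). ?\<chi> ?g * ?\<chi> k)"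
    proof (intro sum.cong refl)
      fix k :: "'p mod_ring poly" assume "k \<in> monic_polys (Suc m - n)"
      then show "?\<chi> (?g * k) = ?\<chi> ?g * ?\<chi> k"
        using g by (subst root_sum_mult) (auto simp: monic_polys_def add_char_add)
    qed
    finally show "(\<Sum>h\<in>?M. if ?g dvd h then ?\<chi> h else 0) = ?\<chi> ?g * L_coeff f (Suc m - n)"
      by (simp add: L_coeff_def sum_distrib_left)
  qed
  also have "\<dots> = (\<Sum>n\<in>{1..Suc m}. ext_char_sum f n * L_coeff f (Suc m - n))"
    by (simp only: ext_char_sum_def sum_distrib_right)
  also have "\<dots> = (\<Sum>n\<le>m. ext_char_sum f (Suc n) * L_coeff f (m - n))"
    by (rule sum.reindex_bij_witness[of _ Suc "\<lambda>n. n - 1"]) auto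
  finally show ?thesis .
qed

lemma ext_char_sum_1:
  fixes f :: "'p::prime_card mod_ring poly"
  shows "ext_char_sum f 1 = (\<Sum>a\<in>UNIV. add_char (poly f a))"
proof -
  have "ext_char_sum f 1 = (\<Sum>a\<in>UNIV. add_char (root_sum f (base_orbit_poly 1 (to_ac a))))"
    unfolding ext_char_sum_def ac_fixed_1 by (subst sum.reindex) (auto simp: inj_to_ac)
  also have "\<dots> = (\<Sum>a\<in>UNIV. add_char (poly f a))"
  proof (intro sum.cong refl arg_cong[where f = add_char])
    fix a :: "'p mod_ring"
    have "to_ac a \<in> ac_fixed 1"
      using to_ac_power_card[of a 1] by simp
    from root_sum_base_orbit_poly[OF this, of f]
    show "root_sum f (base_orbit_poly 1 (to_ac a)) = poly f a"
      by (simp add: ac_trace_def)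
  qed
  finally show ?thesis .
qed

text \<open>Upper bounds for all fibres of the trace suffice: since the fibres partition the
  field, a deficit in one of them is compensated by the others.\<close>
lemma norm_ext_char_sum_even_le:
  fixes f :: "'p::prime_card mod_ring poly"
  assumes "0 < degree f" "degree f < CARD('p)" "r \<ge> 2"
  shows "norm (ext_char_sum f (2 * r)) \<le> CARD('p) * (2 * degree f + 2) * CARD('p) ^ r"
proof -
  define p where "p = CARD('p)"
  define M where "M = real p ^ (2 * r - 1) + (2 * degree f + 2) * real p ^ r"
  let ?A = "\<lambda>b. trace_fiber f (2 * r) b"
  have r: "2 * r > 0" using assms by simp
  have fin: "finite (ac_fixed (2 * r) :: 'p mod_ring alg_closure set)"
    using r by (rule finite_card_ac_fixed)
  have trace_iff: "ac_trace (2 * r) (poly (map_poly to_ac f) x) = to_ac b \<longleftrightarrow>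
      root_sum f (base_orbit_poly (2 * r) x) = b" if "x \<in> ac_fixed (2 * r)" for x b
    by (simp flip: root_sum_base_orbit_poly[OF that r])
  have fiber: "?A b = {x \<in> ac_fixed (2 * r). root_sum f (base_orbit_poly (2 * r) x) = b}" for b
    unfolding trace_fiber_def using trace_iff by auto
  have sum_fibers: "(\<Sum>x\<in>ac_fixed (2 * r). g (root_sum f (base_orbit_poly (2 * r) x))) =
      (\<Sum>b\<in>UNIV. of_nat (card (?A b)) * g b)" for g :: "'p mod_ring \<Rightarrow> complex"
  proof -
    have "(\<Sum>x\<in>ac_fixed (2 * r). g (root_sum f (base_orbit_poly (2 * r) x))) =
        (\<Sum>b\<in>UNIV. \<Sum>x\<in>?A b. g (root_sum f (base_orbit_poly (2 * r) x)))"
      unfolding fiber by (rule sum.group[symmetric]) (use fin in auto)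
    also have "\<dots> = (\<Sum>b\<in>UNIV. of_nat (card (?A b)) * g b)"
      by (intro sum.cong refl) (simp add: fiber)
    finally show ?thesis .
  qed
  have "card (?A b) \<le> p ^ (2 * r - 1) + (2 * degree f + 2) * p ^ r" for b
    unfolding p_def using assms by (intro card_trace_fiber_le)
  then have "real (card (?A b)) \<le> real (p ^ (2 * r - 1) + (2 * degree f + 2) * p ^ r)" for b
    by (intro of_nat_mono)
  then have le: "real (card (?A b)) \<le> M" for b
    by (simp add: M_def algebra_simps)
  have "complex_of_nat (p ^ (2 * r)) = (\<Sum>b\<in>UNIV. of_nat (card (?A b)))"
    using sum_fibers[of "\<lambda>_. 1"] r by (simp add: finite_card_ac_fixed(2) p_def)
  also have "\<dots> = of_nat (\<Sum>b\<in>UNIV. card (?A b))"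
    by simp
  finally have "p ^ (2 * r) = (\<Sum>b\<in>UNIV. card (?A b))"
    by (simp only: of_nat_eq_iff)
  from arg_cong[OF this, of real]
  have total: "(\<Sum>b\<in>UNIV. real (card (?A b))) = real p ^ (2 * r)"
    by simp
  \<comment> \<open>Since the character sums to zero, \<open>M\<close> may be subtracted from every
    fibre size. The differences then have one sign, so their absolute values add up exactly, and
    \<open>p * p ^ (2 * r - 1)\<close> cancels against the total.\<close>
  have "(\<Sum>b\<in>UNIV. add_char (b :: 'p mod_ring)) = 0"
    using sum_add_char[of "1 :: 'p mod_ring"] by simp
  then have "ext_char_sum f (2 * r) = (\<Sum>b\<in>UNIV. of_real (real (card (?A b)) - M) * add_char b)"
    unfolding ext_char_sum_def sum_fibers
    by (simp add: left_diff_distrib sum_subtractf flip: sum_distrib_left)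
  also have "norm \<dots> \<le> (\<Sum>b\<in>UNIV. M - real (card (?A b)))"
    by (rule sum_norm_le) (use le in \<open>simp only: norm_mult norm_of_real norm_add_char\<close>, simp)
  also have "\<dots> = p * M - real p ^ (2 * r)"
    by (simp add: sum_subtractf total p_def)
  also have "\<dots> = p * (2 * degree f + 2) * p ^ r"
  proof -
    have "real p ^ (2 * r) = real p * real p ^ (2 * r - 1)"
      using r by (simp flip: power_Suc)
    then show ?thesis
      by (simp add: M_def algebra_simps)
  qed
  finally show ?thesis by (simp add: p_def)
qed

text \<open>The bound on reciprocal roots applies with \<open>R = sqrt CARD('p)\<close>; the
  constant from Stepanov's estimate is independent of \<open>r\<close> and disappears.\<close>

theorem weil_bound:
  fixes f :: "'p::prime_card mod_ring poly"
  assumes "0 < degree f" "degree f < CARD('p)"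
  shows "norm (\<Sum>a\<in>UNIV. add_char (poly f a)) \<le> (real (degree f) - 1) * sqrt CARD('p)"
proof -
  have "norm (ext_char_sum f 1) \<le> (real (degree f) - 1) * sqrt CARD('p)"
  proof (rule reciprocal_roots_bound[where A = "L_coeff f"])
    show "norm (ext_char_sum f (2 * r)) \<le>
        real (CARD('p) * (2 * degree f + 2)) * (sqrt CARD('p) ^ 2) ^ r" if "r \<ge> 2" for r
      using norm_ext_char_sum_even_le[OF assms that] by simp
  qed (use assms in \<open>auto simp: L_coeff_0 L_coeff_eq_0 L_coeff_recurrence simp del: of_nat_Suc\<close>)
  then show ?thesis
    by (simp only: ext_char_sum_1)
qed

section \<open>Counting subset sums\<close>

text \<open>The elementary symmetric functions are the coefficients of the product of the factors
  \<open>1 + w x * X\<close>; writing these with \<open>- w x\<close> fits the logarithmic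
  derivative and explains the signs.\<close>

lemma elementary_symmetric_newton:
  fixes w :: "'i \<Rightarrow> 'a::comm_ring_1"
  assumes "finite D"
  defines "e \<equiv> \<lambda>n. \<Sum>S\<in>{S. S \<subseteq> D \<and> card S = n}. \<Prod>x\<in>S. w x"
  shows "of_nat (Suc n) * e (Suc n) = - (\<Sum>i\<le>n. (\<Sum>x\<in>D. (- w x) ^ Suc i) * e (n - i))"
proof -
  define E where "E = (\<Prod>x\<in>D. 1 - fps_const (- w x) * fps_X)"
  have E_nth: "E $ n = e n" for n
  proof -
    have "E = (\<Prod>x\<in>D. fps_const (w x) * fps_X + 1)"
      unfolding E_def by (intro prod.cong refl) (simp flip: fps_const_neg)
    also have "\<dots> = (\<Sum>S\<in>Pow D. fps_const (\<Prod>x\<in>S. w x) * fps_X ^ card S)"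
      unfolding prod_add[OF assms(1)]
    proof (intro sum.cong refl)
      fix S assume "S \<in> Pow D"
      have "(\<Prod>x\<in>S. fps_const (w x)) = fps_const (\<Prod>x\<in>S. w x)"
        by (induction S rule: infinite_finite_induct) auto
      then show "(\<Prod>x\<in>S. fps_const (w x) * fps_X) * (\<Prod>x\<in>D - S. 1) =
          fps_const (\<Prod>x\<in>S. w x) * fps_X ^ card S"
        by (simp add: prod.distrib)
    qed
    also have "\<dots> $ n = (\<Sum>S\<in>Pow D. if card S = n then \<Prod>x\<in>S. w x else 0)"
      by (simp add: fps_sum_nth fps_X_power_nth if_distrib eq_commute cong: if_cong)
    also have "\<dots> = e n"
      using assms(1) by (simp add: e_def sum.If_cases Int_def Pow_def)
    finally show ?thesis .
  qed
  have "fps_deriv E = - E * Abs_fps (\<lambda>n. \<Sum>x\<in>D. (- w x) ^ Suc n)"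
    unfolding E_def by (rule fps_deriv_prod_linear[OF assms(1)])
  from fps_log_deriv_nth[OF this, of n] show ?thesis
    by (simp only: E_nth fps_nth_Abs_fps)
qed

text \<open>Orthogonality detects the prescribed sum, and the character of a sum over
  \<open>S\<close> factors over the elements of \<open>S\<close>.\<close>

lemma subset_sum_count_fourier:
  fixes f :: "'p::prime_card mod_ring poly"
  shows "of_nat CARD('p) * of_nat (subset_sum_count f D k b) =
    (\<Sum>a\<in>UNIV. add_char (- (a * b)) *
      (\<Sum>S\<in>{S. S \<subseteq> D \<and> card S = k}. \<Prod>x\<in>S. add_char (a * poly f x)))"
proof -
  let ?N = "{S. S \<subseteq> D \<and> card S = k}"
  have "of_nat CARD('p) * of_nat (subset_sum_count f D k b) =
      (\<Sum>S\<in>?N. if (\<Sum>x\<in>S. poly f x) - b = 0 then of_nat CARD('p) else (0 :: complex))"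
    by (simp add: subset_sum_count_def sum.If_cases Int_def conj_assoc)
  also have "\<dots> = (\<Sum>S\<in>?N. \<Sum>a\<in>UNIV. add_char (a * ((\<Sum>x\<in>S. poly f x) - b)))"
    by (simp only: sum_add_char)
  also have "\<dots> = (\<Sum>S\<in>?N. \<Sum>a\<in>UNIV. add_char (- (a * b)) * (\<Prod>x\<in>S. add_char (a * poly f x)))"
  proof (intro sum.cong refl)
    fix S and a :: "'p mod_ring"
    have "a * ((\<Sum>x\<in>S. poly f x) - b) = - (a * b) + (\<Sum>x\<in>S. a * poly f x)"
      by (simp add: right_diff_distrib sum_distrib_left)
    then show "add_char (a * ((\<Sum>x\<in>S. poly f x) - b)) =
        add_char (- (a * b)) * (\<Prod>x\<in>S. add_char (a * poly f x))"
      by (simp only: add_char_add add_char_sum)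
  qed
  also have "\<dots> = (\<Sum>a\<in>UNIV. add_char (- (a * b)) *
      (\<Sum>S\<in>?N. \<Prod>x\<in>S. add_char (a * poly f x)))"
    by (subst sum.swap) (simp add: sum_distrib_left)
  finally show ?thesis .
qed

lemma add_char_power: "add_char x ^ n = add_char (of_nat n * x)"
  by (induction n) (auto simp: add_char_add distrib_right)

theorem corollary1p5:
  fixes f :: "'p::prime_card mod_ring poly"
    and D :: "'p mod_ring set"
    and b :: "'p mod_ring"
    and p d c k :: nat
  assumes "p = CARD('p)"
    and "prime p"
    and "degree f = d"
    and "0 < d" and "d < p"
    and "real (card D) = real p - real c"
    and "real p - real c \<ge> (real d - 1) * sqrt (real p) + real c"
    and "k \<le> card D"
  shows "\<bar>real (subset_sum_count f D k b) - 1 / real p * ((real p - real c) gchoose k)\<bar>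
    \<le> ((real d - 1) * sqrt (real p) + real c + real k) gchoose k"
proof -
  \<comment> \<open>This bounds the power sums: the Weil bound over the whole field, plus one for
    each of the \<open>c\<close> points outside \<open>D\<close>.\<close>
  define B where "B = (real d - 1) * sqrt (real p) + real c"
  have B: "B \<ge> 0"
    using assms(4) by (auto simp: B_def)
  have p: "p > 0"
    using assms(5) by simp
  have card_D: "card D + c = p"
    using assms(6) by linarith
  define N where "N = {S. S \<subseteq> D \<and> card S = k}"
  have card_N: "card N = card D choose k"
    unfolding N_def by (rule n_subsets) simp
  have choose: "(real p - real c) gchoose k = real (card D choose k)"
    by (simp add: assms(6)[symmetric] binomial_gbinomial)
  have ge1: "1 \<le> (B + real m) gchoose m" for m
    using gbinomial_mono[of m "real m" "B + real m"] B by (simp flip: binomial_gbinomial)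
  \<comment> \<open>Newton's identities yield \<open>B + k - 1\<close>; Pascal's rule passes to the
    \<open>B + k\<close> of the claim.\<close>
  have mono: "B + real k - 1 gchoose k \<le> B + real k gchoose k"
  proof (cases k)
    case (Suc m)
    have "(B + real m + 1) gchoose Suc m = ((B + real m) gchoose m) + ((B + real m) gchoose Suc m)"
      by (rule gbinomial_Suc_Suc)
    then show ?thesis
      using ge1[of m] by (simp add: Suc algebra_simps)
  qed simp
  have "\<bar>real (subset_sum_count f D k b) - 1 / real p * real (card D choose k)\<bar> \<le> B + real k gchoose k"
  proof (cases "k < p")
    case True
    define e where "e a n = (\<Sum>S\<in>{S. S \<subseteq> D \<and> card S = n}. \<Prod>x\<in>S. add_char (a * poly f x))" for a n
    have e0: "e 0 k = of_nat (card D choose k)"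
      by (simp add: e_def card_N[unfolded N_def])
    have e: "norm (e a k) \<le> B + real k - 1 gchoose k" if a: "a \<noteq> 0" for a
    proof (rule norm_elementary_le[where e = "e a" and k = k])
      have "{S. S \<subseteq> D \<and> card S = 0} = {{}}"
        by (auto simp: card_eq_0_iff)
      then show "e a 0 = 1"
        by (simp add: e_def)
      show "of_nat (Suc n) * e a (Suc n) =
          - (\<Sum>i\<le>n. (\<Sum>x\<in>D. (- add_char (a * poly f x)) ^ Suc i) * e a (n - i))" for n
        unfolding e_def by (rule elementary_symmetric_newton) simp
      show "norm (\<Sum>x\<in>D. (- add_char (a * poly f x)) ^ Suc i) \<le> B" if "i < k" for i
      proof -
        \<comment> \<open>The power \<open>i + 1\<close> of a character value is the character at
          \<open>s * poly f x\<close>, and \<open>s\<close> is nonzero because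
          \<open>0 < i + 1 \<le> k < p\<close>. So each power sum is, up to sign, a character sum of
          a polynomial of degree \<open>d\<close>.\<close>
        define s where "s = of_nat (Suc i) * a"
        have "(of_nat (Suc i) :: 'p mod_ring) \<noteq> 0"
          unfolding of_nat_eq_0_iff_char_dvd using that True assms(1) by (auto dest: dvd_imp_le)
        then have s: "s \<noteq> 0"
          using a by (simp add: s_def del: of_nat_Suc)
        have all: "norm (\<Sum>x\<in>UNIV. add_char (s * poly f x)) \<le> (real d - 1) * sqrt (real p)"
          using weil_bound[of "smult s f"] s assms by simp
        have rest: "norm (\<Sum>x\<in>- D. add_char (s * poly f x)) \<le> real c"
        proof -
          have "norm (\<Sum>x\<in>- D. add_char (s * poly f x)) \<le> (\<Sum>x\<in>- D. 1)"
            by (rule sum_norm_le) simp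
          also have "\<dots> = real c"
            using card_D assms(1) by (simp add: Compl_eq_Diff_UNIV card_Diff_subset of_nat_diff)
          finally show ?thesis .
        qed
        have "(\<Sum>x\<in>UNIV. add_char (s * poly f x)) =
            (\<Sum>x\<in>D. add_char (s * poly f x)) + (\<Sum>x\<in>- D. add_char (s * poly f x))"
          using sum.union_disjoint[of D "- D"] by simp
        then have "norm (\<Sum>x\<in>D. add_char (s * poly f x)) =
            norm ((\<Sum>x\<in>UNIV. add_char (s * poly f x)) - (\<Sum>x\<in>- D. add_char (s * poly f x)))"
          by simp
        also have "\<dots> \<le> B"
          using norm_triangle_ineq4 all rest unfolding B_def by (smt (verit))
        finally have "norm (\<Sum>x\<in>D. add_char (s * poly f x)) \<le> B" .
        moreover have "(- add_char (a * poly f x)) ^ Suc i = (- 1) ^ Suc i * add_char (s * poly f x)" for x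
          by (subst power_minus) (simp only: add_char_power s_def mult.assoc)
        then have "norm (\<Sum>x\<in>D. (- add_char (a * poly f x)) ^ Suc i) =
            norm (\<Sum>x\<in>D. add_char (s * poly f x))"
          by (simp add: norm_mult norm_power flip: sum_distrib_left del: power_Suc)
        ultimately show ?thesis by simp
      qed
    qed simp
    have "of_nat p * of_nat (subset_sum_count f D k b) = (\<Sum>a\<in>UNIV. add_char (- (a * b)) * e a k)"
      unfolding assms(1) e_def by (rule subset_sum_count_fourier)
    also have "\<dots> = e 0 k + (\<Sum>a\<in>UNIV - {0}. add_char (- (a * b)) * e a k)"
      by (subst sum.remove[of _ 0]) auto
    finally have "complex_of_real (real p * real (subset_sum_count f D k b) - real (card D choose k)) =
        (\<Sum>a\<in>UNIV - {0}. add_char (- (a * b)) * e a k)"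
      by (simp add: e0)
    then have "\<bar>real p * real (subset_sum_count f D k b) - real (card D choose k)\<bar> =
        norm (\<Sum>a\<in>UNIV - {0}. add_char (- (a * b)) * e a k)"
      by (metis norm_of_real)
    also have "\<dots> \<le> (\<Sum>a\<in>UNIV - {0 :: 'p mod_ring}. B + real k gchoose k)"
      by (rule sum_norm_le) (use e mono in \<open>fastforce simp: norm_mult\<close>)
    also have "\<dots> \<le> real p * (B + real k gchoose k)"
      using assms(1) ge1[of k] by (simp add: card_Diff_singleton mult_right_mono)
    finally have "real p * \<bar>real (subset_sum_count f D k b) - 1 / real p * real (card D choose k)\<bar> \<le>
        real p * (B + real k gchoose k)"
      using p by (simp add: abs_mult[symmetric, of "real p", simplified] right_diff_distrib)
    then show ?thesis
      using p by simp
  next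
    \<comment> \<open>Here \<open>D\<close> is the whole field, so exactly one subset has
      \<open>k\<close> elements; the error is at most \<open>1\<close>, and so is \<open>1\<close>
      at most the right-hand side.\<close>
    case False
    then have k: "k = card D" "k = p"
      using assms(8) card_D by auto
    have "subset_sum_count f D k b \<le> card N"
      unfolding subset_sum_count_def N_def by (intro card_mono) auto
    then have "subset_sum_count f D k b \<le> 1"
      using card_N k by simp
    then have "subset_sum_count f D k b = 0 \<or> subset_sum_count f D k b = 1"
      by linarith
    moreover have "1 / real p \<le> 1" "1 / real p \<ge> 0"
      using p by auto
    ultimately have "\<bar>real (subset_sum_count f D k b) - 1 / real p * real (card D choose k)\<bar> \<le> 1"
      using k by auto
    also note ge1[of k]
    finally show ?thesis .
  qed
  then show ?thesis
    by (simp add: choose B_def)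
qed

end
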